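(* Let $(B,g_B)$ and $(F,g_F)$ be Riemannian manifolds of dimensions $n_1=\dim B$ and $n_2=\dim F$, let $n=n_1+n_2$, let $f$ be a positive differentiable function on $B$, and let $(B\times_f F,g)$ be the warped product manifold with metric $g=g_B+f^2g_F$. Let $\phi$ be an isometric immersion from $(B\times_f F,g)$ to the Clifford torus $\overline{M}_{m_1,m_2}=S^{m_1}\big(\sqrt{\tfrac{m_1}{m}}\big)\times S^{m_2}\big(\sqrt{\tfrac{m_2}{m}}\big)$ with $2\le m_1\le\frac m2$, $m=m_1+m_2$, and $m\ge4$. Then, at every point, $$\frac{\triangle f}{f}\le\frac{n^2}{4n_2}H^2+\frac{n_1m}{m_1}.$$
   Context: Manifolds have positive dimension and "differentiable" means smooth. The warped product $M=B\times_f F$ is $B\times F$ with the metric $g$ given by $\|X\|^2=\|d\pi_1X\|^2+f^2(\pi_1(x))\|d\pi_2X\|^2$ for $X\in T_xM$, where $\pi_1:B\times F\to B$ and $\pi_2:B\times F\to F$ are the projections; functions on $B$ are regarded as functions on $M$ via $\pi_1$. $\mathcal{D}_1$ is the distribution on $M$ of vectors tangent to the lifts of $B$. Laplacian: $\triangle f=\sum_{i=1}^{n_1}\big((\nabla_{e_i}e_i)f-e_i^2f\big)$, where $e_1,\dots,e_{n_1}$ is a local orthonormal frame of $\mathcal{D}_1$ consisting of lifts of a local orthonormal frame of $B$ and $\nabla$ is the Levi-Civita connection of $(M,g)$; equivalently, $\triangle f=-\mathrm{div}(\mathrm{grad}\,f)$ computed on $(B,g_B)$ (note the sign). With $h$ the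 second fundamental form of $\phi$ and $e_1,\dots,e_n$ a local orthonormal frame of $TM$, the mean curvature vector is $\overrightarrow{H}=\frac1n\sum_{i=1}^n h(e_i,e_i)$ and $H^2=\langle\overrightarrow{H},\overrightarrow{H}\rangle$. $S^k(r)$ denotes the $k$-dimensional round sphere of radius $r$ in $\mathbb{R}^{k+1}$ (constant sectional curvature $1/r^2$); the Clifford torus $\overline{M}_{m_1,m_2}\subset S^{m+1}(1)$ carries the Riemannian product metric. *)

theory Defs
  imports "HOL-Analysis.Analysis"
begin

text \<open>Smoothness on an open subset of a Euclidean space.  For open \<open>S\<close>, a function is
  \<open>C\<^sup>k\<^sup>+\<^sup>1\<close> iff it is differentiable and all its directional derivatives are \<open>C\<^sup>k\<close>.\<close>

primrec Ck_on :: "nat \<Rightarrow> 'a::euclidean_space set \<Rightarrow> ('a \<Rightarrow> 'b::real_normed_vector) \<Rightarrow> bool" where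
  "Ck_on 0 S f \<longleftrightarrow> continuous_on S f"
| "Ck_on (Suc k) S f \<longleftrightarrow>
     (\<forall>x\<in>S. f differentiable (at x)) \<and> (\<forall>v. Ck_on k S (\<lambda>x. frechet_derivative f (at x) v))"

definition smooth_on :: "'a::euclidean_space set \<Rightarrow> ('a \<Rightarrow> 'b::real_normed_vector) \<Rightarrow> bool" where
  "smooth_on S f \<longleftrightarrow> (\<forall>k. Ck_on k S f)"


section \<open>Riemannian manifolds\<close>

text \<open>A manifold is a topological space with an atlas indexed by a set \<open>chart_index\<close>; the charts
  take values in the Euclidean space \<open>'e\<close>, whose dimension (which is positive) is the dimension of
  the manifold.  Tangent vectors at \<open>p\<close> are given by their components, elements of \<open>'e\<close>, with
  respect to a chart: \<open>rmetric M i p u v\<close> is the inner product at \<open>p\<close> of the vectors with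
  components \<open>u\<close> and \<open>v\<close> in the chart \<open>i\<close>.\<close>

record ('p, 'i, 'e) riem =
  mtop :: "'p topology"
  chart_index :: "'i set"
  chart_dom :: "'i \<Rightarrow> 'p set"
  chart_map :: "'i \<Rightarrow> 'p \<Rightarrow> 'e"
  rmetric :: "'i \<Rightarrow> 'p \<Rightarrow> 'e \<Rightarrow> 'e \<Rightarrow> real"

definition chart_at :: "('p, 'i, 'e) riem \<Rightarrow> 'i \<Rightarrow> 'p \<Rightarrow> bool" where
  "chart_at M i p \<longleftrightarrow> i \<in> chart_index M \<and> p \<in> chart_dom M i"

definition chart_range :: "('p, 'i, 'e) riem \<Rightarrow> 'i \<Rightarrow> 'e set" where
  "chart_range M i = chart_map M i ` chart_dom M i"

definition chart_inv :: "('p, 'i, 'e) riem \<Rightarrow> 'i \<Rightarrow> 'e \<Rightarrow> 'p" where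
  "chart_inv M i = inv_into (chart_dom M i) (chart_map M i)"

definition transition :: "('p, 'i, 'e) riem \<Rightarrow> 'i \<Rightarrow> 'i \<Rightarrow> 'e \<Rightarrow> 'e" where
  "transition M i j = chart_map M j \<circ> chart_inv M i"

definition smooth_manifold :: "('p, 'i, 'e::euclidean_space) riem \<Rightarrow> bool" where
  "smooth_manifold M \<longleftrightarrow>
     Hausdorff_space (mtop M) \<and> second_countable (mtop M) \<and>
     (\<Union>i\<in>chart_index M. chart_dom M i) = topspace (mtop M) \<and>
     (\<forall>i\<in>chart_index M. openin (mtop M) (chart_dom M i) \<and> open (chart_range M i) \<and>
        homeomorphic_map (subtopology (mtop M) (chart_dom M i)) (top_of_set (chart_range M i))
          (chart_map M i)) \<and>
     (\<forall>i\<in>chart_index M. \<forall>j\<in>chart_index M.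
        smooth_on (chart_map M i ` (chart_dom M i \<inter> chart_dom M j)) (transition M i j))"

definition inner_product :: "('e::real_vector \<Rightarrow> 'e \<Rightarrow> real) \<Rightarrow> bool" where
  "inner_product b \<longleftrightarrow> bilinear b \<and> (\<forall>u v. b u v = b v u) \<and> (\<forall>u. u \<noteq> 0 \<longrightarrow> b u u > 0)"

definition local_metric ::
    "('p, 'i, 'e::euclidean_space) riem \<Rightarrow> 'i \<Rightarrow> 'e \<Rightarrow> 'e \<Rightarrow> 'e \<Rightarrow> real" where
  "local_metric M i y = rmetric M i (chart_inv M i y)"

definition riemannian_manifold :: "('p, 'i, 'e::euclidean_space) riem \<Rightarrow> bool" where
  "riemannian_manifold M \<longleftrightarrow> smooth_manifold M \<and>
     (\<forall>i p. chart_at M i p \<longrightarrow> inner_product (rmetric M i p)) \<and>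
     (\<forall>i\<in>chart_index M. \<forall>u v. smooth_on (chart_range M i) (\<lambda>y. local_metric M i y u v)) \<and>
     (\<forall>i j p u v. chart_at M i p \<and> chart_at M j p \<longrightarrow>
        (let T = frechet_derivative (transition M i j) (at (chart_map M i p))
         in rmetric M i p u v = rmetric M j p (T u) (T v)))"

definition smooth_function :: "('p, 'i, 'e::euclidean_space) riem \<Rightarrow> ('p \<Rightarrow> real) \<Rightarrow> bool" where
  "smooth_function M f \<longleftrightarrow> (\<forall>i\<in>chart_index M. smooth_on (chart_range M i) (f \<circ> chart_inv M i))"

definition local_map ::
    "('p, 'i, 'e) riem \<Rightarrow> 'i \<Rightarrow> ('q, 'j, 'd) riem \<Rightarrow> 'j \<Rightarrow> ('p \<Rightarrow> 'q) \<Rightarrow> 'e \<Rightarrow> 'd" where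
  "local_map M i N k \<phi> = chart_map N k \<circ> \<phi> \<circ> chart_inv M i"

definition differential ::
    "('p, 'i, 'e::euclidean_space) riem \<Rightarrow> 'i \<Rightarrow> ('q, 'j, 'd::euclidean_space) riem \<Rightarrow> 'j \<Rightarrow>
     ('p \<Rightarrow> 'q) \<Rightarrow> 'p \<Rightarrow> 'e \<Rightarrow> 'd" where
  "differential M i N k \<phi> p = frechet_derivative (local_map M i N k \<phi>) (at (chart_map M i p))"

definition smooth_map ::
    "('p, 'i, 'e::euclidean_space) riem \<Rightarrow> ('q, 'j, 'd::euclidean_space) riem \<Rightarrow> ('p \<Rightarrow> 'q) \<Rightarrow> bool" where
  "smooth_map M N \<phi> \<longleftrightarrow> continuous_map (mtop M) (mtop N) \<phi> \<and>
     (\<forall>i\<in>chart_index M. \<forall>k\<in>chart_index N.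
        smooth_on (chart_map M i ` {p \<in> chart_dom M i. \<phi> p \<in> chart_dom N k}) (local_map M i N k \<phi>))"

definition isometric_immersion ::
    "('p, 'i, 'e::euclidean_space) riem \<Rightarrow> ('q, 'j, 'd::euclidean_space) riem \<Rightarrow> ('p \<Rightarrow> 'q) \<Rightarrow> bool" where
  "isometric_immersion M N \<phi> \<longleftrightarrow> smooth_map M N \<phi> \<and>
     (\<forall>i k p. chart_at M i p \<and> chart_at N k (\<phi> p) \<longrightarrow>
        inj (differential M i N k \<phi> p) \<and>
        (\<forall>u v. rmetric M i p u v =
           rmetric N k (\<phi> p) (differential M i N k \<phi> p u) (differential M i N k \<phi> p v)))"


section \<open>Warped products, spheres and Clifford tori\<close>

definition warped_product ::
    "('b, 'i, 'e1) riem \<Rightarrow> ('b \<Rightarrow> real) \<Rightarrow> ('c, 'j, 'e2) riem \<Rightarrow> ('b \<times> 'c, 'i \<times> 'j, 'e1 \<times> 'e2) riem" where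
  "warped_product B f F = \<lparr>
     mtop = prod_topology (mtop B) (mtop F),
     chart_index = chart_index B \<times> chart_index F,
     chart_dom = (\<lambda>(i, j). chart_dom B i \<times> chart_dom F j),
     chart_map = (\<lambda>(i, j) (x, y). (chart_map B i x, chart_map F j y)),
     rmetric = (\<lambda>(i, j) (x, y) u v.
       rmetric B i x (fst u) (fst v) + (f x)\<^sup>2 * rmetric F j y (snd u) (snd v)) \<rparr>"

definition riemannian_product ::
    "('b, 'i, 'e1) riem \<Rightarrow> ('c, 'j, 'e2) riem \<Rightarrow> ('b \<times> 'c, 'i \<times> 'j, 'e1 \<times> 'e2) riem" where
  "riemannian_product M N = warped_product M (\<lambda>_. 1) N"

text \<open>A submanifold \<open>S\<close> of a Euclidean space, of dimension \<open>DIM('e)\<close>, with the induced metric.  The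
  atlas consists of all pairs \<open>(U, c)\<close> such that \<open>c\<close> is a homeomorphism from an open subset \<open>U\<close> of
  \<open>S\<close> onto an open subset of \<open>'e\<close> whose inverse is a smooth immersion into the ambient space;
  the pair itself serves as its index.\<close>

definition euclidean_submanifold ::
    "'s::euclidean_space set \<Rightarrow> ('s, 's set \<times> ('s \<Rightarrow> 'e), 'e::euclidean_space) riem" where
  "euclidean_submanifold S = \<lparr>
     mtop = top_of_set S,
     chart_index = {(U, c). openin (top_of_set S) U \<and> open (c ` U) \<and>
       homeomorphic_map (top_of_set U) (top_of_set (c ` U)) c \<and>
       smooth_on (c ` U) (inv_into U c) \<and>
       (\<forall>y\<in>c ` U. inj (frechet_derivative (inv_into U c) (at y)))},
     chart_dom = fst,
     chart_map = snd,
     rmetric = (\<lambda>(U, c) p u v.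
       let D = frechet_derivative (inv_into U c) (at (c p)) in D u \<bullet> D v) \<rparr>"

text \<open>The sphere of dimension \<open>DIM('u)\<close>; its ambient space \<open>'u \<times> real\<close> with the product norm is the
  Euclidean space of dimension \<open>DIM('u) + 1\<close>.\<close>

definition round_sphere ::
    "real \<Rightarrow> ('u::euclidean_space \<times> real, ('u \<times> real) set \<times> ('u \<times> real \<Rightarrow> 'u), 'u) riem" where
  "round_sphere r = euclidean_submanifold (sphere 0 r)"

type_synonym 'u sphere_chart = "('u \<times> real) set \<times> ('u \<times> real \<Rightarrow> 'u)"

text \<open>The Clifford torus with \<open>m\<^sub>1 = DIM('u)\<close>, \<open>m\<^sub>2 = DIM('v)\<close> and \<open>m = m\<^sub>1 + m\<^sub>2\<close>.\<close>

definition clifford_torus ::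
    "(('u::euclidean_space \<times> real) \<times> ('v::euclidean_space \<times> real),
      'u sphere_chart \<times> 'v sphere_chart, 'u \<times> 'v) riem" where
  "clifford_torus = riemannian_product
     (round_sphere (sqrt (real DIM('u) / real (DIM('u) + DIM('v)))))
     (round_sphere (sqrt (real DIM('v) / real (DIM('u) + DIM('v)))))"


section \<open>Levi-Civita connection and second fundamental form in a chart\<close>

text \<open>In the following, vector fields are given by their components in a chart, as functions of
  the coordinates, and \<open>g\<close> is a metric in coordinates, as provided by \<open>local_metric\<close>.\<close>

definition dir_deriv ::
    "('e::euclidean_space \<Rightarrow> 'e) \<Rightarrow> ('e \<Rightarrow> 'a::real_normed_vector) \<Rightarrow> 'e \<Rightarrow> 'a" where
  "dir_deriv X h y = frechet_derivative h (at y) (X y)"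

text \<open>\<open>christoffel g y u v\<close> is the covariant derivative at \<open>y\<close> of the coordinate-constant field \<open>v\<close>
  in direction \<open>u\<close>.  The two conditions that determine it say that the connection is torsion free
  and compatible with \<open>g\<close>.\<close>

definition christoffel ::
    "('e::euclidean_space \<Rightarrow> 'e \<Rightarrow> 'e \<Rightarrow> real) \<Rightarrow> 'e \<Rightarrow> 'e \<Rightarrow> 'e \<Rightarrow> 'e" where
  "christoffel g y = (THE \<Gamma>. bilinear \<Gamma> \<and> (\<forall>u v. \<Gamma> u v = \<Gamma> v u) \<and>
     (\<forall>u v w. frechet_derivative (\<lambda>z. g z v w) (at y) u = g y (\<Gamma> u v) w + g y v (\<Gamma> u w)))"

definition levi_civita ::
    "('e::euclidean_space \<Rightarrow> 'e \<Rightarrow> 'e \<Rightarrow> real) \<Rightarrow> ('e \<Rightarrow> 'e) \<Rightarrow> ('e \<Rightarrow> 'e) \<Rightarrow> 'e \<Rightarrow> 'e" where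
  "levi_civita g X Y y = dir_deriv X Y y + christoffel g y (X y) (Y y)"

text \<open>The covariant derivative, in direction \<open>X\<close>, of a vector field \<open>V\<close> along the map \<open>\<psi>\<close>; here \<open>g\<close>
  is the metric of the target.\<close>

definition levi_civita_along ::
    "('d::euclidean_space \<Rightarrow> 'd \<Rightarrow> 'd \<Rightarrow> real) \<Rightarrow> ('e::euclidean_space \<Rightarrow> 'd) \<Rightarrow>
     ('e \<Rightarrow> 'e) \<Rightarrow> ('e \<Rightarrow> 'd) \<Rightarrow> 'e \<Rightarrow> 'd" where
  "levi_civita_along g \<psi> X V y =
     dir_deriv X V y + christoffel g (\<psi> y) (dir_deriv X \<psi> y) (V y)"

text \<open>The second fundamental form of an isometric immersion \<open>\<phi>\<close>, by the Gauss formula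
  \<open>\<nabla>'\<^sub>X \<phi>\<^sub>*Y = \<phi>\<^sub>*(\<nabla>\<^sub>X Y) + h(X, Y)\<close>; the value is a tangent vector of \<open>N\<close> in the chart \<open>k\<close>, and
  the argument \<open>y\<close> is the coordinate of the point in the chart \<open>i\<close> of \<open>M\<close>.\<close>

definition second_fundamental_form ::
    "('p, 'i, 'e::euclidean_space) riem \<Rightarrow> 'i \<Rightarrow> ('q, 'j, 'd::euclidean_space) riem \<Rightarrow> 'j \<Rightarrow>
     ('p \<Rightarrow> 'q) \<Rightarrow> ('e \<Rightarrow> 'e) \<Rightarrow> ('e \<Rightarrow> 'e) \<Rightarrow> 'e \<Rightarrow> 'd" where
  "second_fundamental_form M i N k \<phi> X Y y =
     (let \<psi> = local_map M i N k \<phi>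
      in levi_civita_along (local_metric N k) \<psi> X (dir_deriv Y \<psi>) y
         - dir_deriv (levi_civita (local_metric M i) X Y) \<psi> y)"

text \<open>\<open>e 1, \<dots>, e DIM('e)\<close> is an orthonormal frame on a neighbourhood of \<open>p\<close> contained in the domain
  of the chart \<open>i\<close>.\<close>

definition local_orthonormal_frame ::
    "('p, 'i, 'e::euclidean_space) riem \<Rightarrow> 'i \<Rightarrow> 'p \<Rightarrow> (nat \<Rightarrow> 'e \<Rightarrow> 'e) \<Rightarrow> bool" where
  "local_orthonormal_frame M i p e \<longleftrightarrow> chart_at M i p \<and>
     (\<exists>V. open V \<and> chart_map M i p \<in> V \<and> V \<subseteq> chart_range M i \<and>
        (\<forall>a\<in>{1..DIM('e)}. smooth_on V (e a)) \<and>
        (\<forall>y\<in>V. \<forall>a\<in>{1..DIM('e)}. \<forall>b\<in>{1..DIM('e)}.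
           local_metric M i y (e a y) (e b y) = (if a = b then 1 else 0)))"

definition mean_curvature_vector ::
    "('p, 'i, 'e::euclidean_space) riem \<Rightarrow> 'i \<Rightarrow> ('q, 'j, 'd::euclidean_space) riem \<Rightarrow> 'j \<Rightarrow>
     ('p \<Rightarrow> 'q) \<Rightarrow> (nat \<Rightarrow> 'e \<Rightarrow> 'e) \<Rightarrow> 'p \<Rightarrow> 'd" where
  "mean_curvature_vector M i N k \<phi> e p =
     (1 / real DIM('e)) *\<^sub>R
       (\<Sum>a = 1..DIM('e). second_fundamental_form M i N k \<phi> (e a) (e a) (chart_map M i p))"

definition squared_mean_curvature ::
    "('p, 'i, 'e::euclidean_space) riem \<Rightarrow> 'i \<Rightarrow> ('q, 'j, 'd::euclidean_space) riem \<Rightarrow> 'j \<Rightarrow>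
     ('p \<Rightarrow> 'q) \<Rightarrow> (nat \<Rightarrow> 'e \<Rightarrow> 'e) \<Rightarrow> 'p \<Rightarrow> real" where
  "squared_mean_curvature M i N k \<phi> e p =
     rmetric N k (\<phi> p) (mean_curvature_vector M i N k \<phi> e p) (mean_curvature_vector M i N k \<phi> e p)"

definition horizontal_lift ::
    "('e1 \<Rightarrow> 'e1) \<Rightarrow> 'e1 \<times> 'e2 \<Rightarrow> 'e1 \<times> 'e2::zero" where
  "horizontal_lift X z = (X (fst z), 0)"

text \<open>The Laplacian, with the sign convention \<open>\<triangle>f = \<Sum>\<^sub>a ((\<nabla>\<^bsub>e\<^sub>a\<^esub> e\<^sub>a) f - e\<^sub>a (e\<^sub>a f))\<close>, of a function \<open>f\<close> on
  \<open>B\<close> regarded as a function on \<open>B \<times>\<^sub>f F\<close>.  The fields \<open>e\<^sub>a\<close> are the lifts of the members of the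
  local orthonormal frame \<open>e\<close> of \<open>B\<close>, and \<open>\<nabla>\<close> is the Levi-Civita connection of \<open>B \<times>\<^sub>f F\<close>.\<close>

definition laplacian ::
    "('b, 'i, 'e1::euclidean_space) riem \<Rightarrow> 'i \<Rightarrow> ('c, 'j, 'e2::euclidean_space) riem \<Rightarrow> 'j \<Rightarrow>
     (nat \<Rightarrow> 'e1 \<Rightarrow> 'e1) \<Rightarrow> ('b \<Rightarrow> real) \<Rightarrow> 'b \<times> 'c \<Rightarrow> real" where
  "laplacian B i F j e f p =
     (let M = warped_product B f F;
          h = f \<circ> fst \<circ> chart_inv M (i, j);
          E = (\<lambda>a. horizontal_lift (e a) :: 'e1 \<times> 'e2 \<Rightarrow> 'e1 \<times> 'e2);
          z = chart_map M (i, j) p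
      in \<Sum>a = 1..DIM('e1).
           dir_deriv (levi_civita (local_metric M (i, j)) (E a) (E a)) h z
           - dir_deriv (E a) (dir_deriv (E a) h) z)"

end

theory Submission
  imports Defs
begin

text \<open>Let \<open>\<psi>\<close> be \<open>\<phi>\<close> followed by the inclusion of the torus into Euclidean space.  For a horizontal
  \<open>a\<close> and a vertical \<open>b\<close>, differentiating the metric relations of the warped product gives the Gauss
  equation \<open>\<langle>h'(a, a), h'(b, b)\<rangle> - \<bar>h'(a, b)\<bar>\<^sup>2 = (Df(\<nabla>\<^sub>a a) - D\<^sup>2f(a, a)) / f\<close> for unit \<open>a\<close>, \<open>b\<close> and the second
  fundamental form \<open>h'\<close> of \<open>\<psi>\<close>.  Drop \<open>\<bar>h'(a, b)\<bar>\<^sup>2\<close> and split \<open>h'\<close> orthogonally into that of \<open>\<phi>\<close> and that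
  of the torus.  The contribution of the torus to \<open>\<langle>h'(a, a), h'(b, b)\<rangle>\<close> is
  \<open>(m/m\<^sub>1) \<bar>a\<^sub>1\<bar>\<^sup>2\<bar>b\<^sub>1\<bar>\<^sup>2 + (m/m\<^sub>2) \<bar>a\<^sub>2\<bar>\<^sup>2\<bar>b\<^sub>2\<bar>\<^sup>2 \<le> m/m\<^sub>1\<close>.  Summing over orthonormal bases of the horizontal
  and vertical spaces, the partial traces \<open>T\<^sub>1\<close>, \<open>T\<^sub>2\<close> of the second fundamental form of \<open>\<phi>\<close> satisfy
  \<open>T\<^sub>1 \<bullet> T\<^sub>2 \<le> \<bar>T\<^sub>1 + T\<^sub>2\<bar>\<^sup>2 / 4 = n\<^sup>2 H\<^sup>2 / 4\<close>.\<close>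

section \<open>Calculus of \<open>C\<^sup>k\<close> maps\<close>

abbreviation fderiv :: "('a::real_normed_vector \<Rightarrow> 'b::real_normed_vector) \<Rightarrow> 'a \<Rightarrow> 'a \<Rightarrow> 'b" where
  "fderiv f x \<equiv> frechet_derivative f (at x)"

text \<open>An iterated directional derivative with inner direction \<open>v\<close> and outer
  direction \<open>u\<close>. It follows the recursion of \<open>Ck_on\<close>, which speaks of
  fixed directions only; linearity and symmetry are proved below.\<close>

definition second_deriv ::
    "('a::real_normed_vector \<Rightarrow> 'b::real_normed_vector) \<Rightarrow> 'a \<Rightarrow> 'a \<Rightarrow> 'a \<Rightarrow> 'b" where
  "second_deriv f x u v = fderiv (\<lambda>y. fderiv f y v) x u"

lemma fderiv_eqI: "(f has_derivative f') (at x) \<Longrightarrow> fderiv f x = f'"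
  by (metis frechet_derivative_at)

lemma has_derivative_fderiv:
  "f differentiable (at x) \<Longrightarrow> (f has_derivative fderiv f x) (at x)"
  by (simp add: frechet_derivative_works)

lemma fderiv_bounded_linear_compose:
  assumes "bounded_linear L" "f differentiable (at x)"
  shows "(\<lambda>x. L (f x)) differentiable (at x)" "fderiv (\<lambda>x. L (f x)) x v = L (fderiv f x v)"
proof -
  have *: "((\<lambda>x. L (f x)) has_derivative (\<lambda>v. L (fderiv f x v))) (at x)"
    by (rule bounded_linear.has_derivative[OF assms(1) has_derivative_fderiv[OF assms(2)]])
  show "(\<lambda>x. L (f x)) differentiable (at x)" using * unfolding differentiable_def by blast
  show "fderiv (\<lambda>x. L (f x)) x v = L (fderiv f x v)" using fderiv_eqI[OF *] by simp
qed

lemma fderiv_bounded_bilinear: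
  assumes "bounded_bilinear B" "f differentiable (at x)" "g differentiable (at x)"
  shows "(\<lambda>x. B (f x) (g x)) differentiable (at x)"
    and "fderiv (\<lambda>x. B (f x) (g x)) x v = B (f x) (fderiv g x v) + B (fderiv f x v) (g x)"
proof -
  have *: "((\<lambda>x. B (f x) (g x)) has_derivative
      (\<lambda>v. B (f x) (fderiv g x v) + B (fderiv f x v) (g x))) (at x)"
    by (rule bounded_bilinear.FDERIV[OF assms(1) has_derivative_fderiv[OF assms(2)]
          has_derivative_fderiv[OF assms(3)]])
  show "(\<lambda>x. B (f x) (g x)) differentiable (at x)" using * unfolding differentiable_def by blast
  show "fderiv (\<lambda>x. B (f x) (g x)) x v = B (f x) (fderiv g x v) + B (fderiv f x v) (g x)"
    using fderiv_eqI[OF *] by simp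
qed

section \<open>Closure properties of \<open>Ck_on\<close>\<close>

lemma Ck_on_subset: "Ck_on k S f \<Longrightarrow> T \<subseteq> S \<Longrightarrow> Ck_on k T f"
  by (induction k arbitrary: f) (auto intro: continuous_on_subset)

lemma Ck_on_Suc_imp: "Ck_on (Suc k) S f \<Longrightarrow> Ck_on k S f"
proof (induction k arbitrary: f)
  case 0
  then show ?case
    by (auto intro!: continuous_at_imp_continuous_on differentiable_imp_continuous_within)
next
  case (Suc k)
  then show ?case by (metis Ck_on.simps(2))
qed

lemma Ck_on_mono: "Ck_on k S f \<Longrightarrow> l \<le> k \<Longrightarrow> Ck_on l S f"
proof -
  assume "l \<le> k" "Ck_on k S f"
  then show "Ck_on l S f"
    by (induction rule: inc_induct) (auto dest: Ck_on_Suc_imp simp del: Ck_on.simps)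
qed

text \<open>Openness of \<open>S\<close> makes \<open>f\<close> and \<open>g\<close> agree near each
  point, so their derivatives agree on \<open>S\<close> and the induction can pass to them.\<close>

lemma Ck_on_cong:
  assumes "open S" "\<And>x. x \<in> S \<Longrightarrow> f x = g x" "Ck_on k S f"
  shows "Ck_on k S g"
  using assms(2,3)
proof (induction k arbitrary: f g)
  case 0
  then show ?case using continuous_on_cong[of S S f g] by simp
next
  case (Suc k)
  have d: "f differentiable (at x)" if "x \<in> S" for x using Suc.prems that by simp
  have "(g has_derivative fderiv f x) (at x)" if "x \<in> S" for x
    by (rule has_derivative_transform_within_open[OF has_derivative_fderiv[OF d[OF that]] assms(1) that])
      (simp add: Suc.prems(1))
  then have "g differentiable (at x)" "fderiv g x = fderiv f x" if "x \<in> S" for x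
    using that fderiv_eqI unfolding differentiable_def by blast+
  moreover have "Ck_on k S (\<lambda>x. fderiv g x v)" for v
    by (rule Suc.IH[of "\<lambda>x. fderiv f x v"]) (use calculation Suc.prems in auto)
  ultimately show ?case by simp
qed

lemma Ck_on_const: "Ck_on k S (\<lambda>x. c)"
  by (induction k arbitrary: c) auto

lemma Ck_on_linear: "bounded_linear L \<Longrightarrow> Ck_on k S L"
  by (cases k)
    (auto simp: linear_continuous_on bounded_linear_imp_differentiable
      fderiv_eqI[OF bounded_linear_imp_has_derivative] Ck_on_const)

lemma Ck_on_bounded_linear_compose:
  assumes "bounded_linear L" "open S"
  shows "Ck_on k S f \<Longrightarrow> Ck_on k S (\<lambda>x. L (f x))"
proof (induction k arbitrary: f)
  case 0
  then show ?case using bounded_linear.continuous_on[OF assms(1)] by simp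
next
  case (Suc k)
  note c = fderiv_bounded_linear_compose[OF assms(1)]
  have "Ck_on k S (\<lambda>x. fderiv (\<lambda>x. L (f x)) x v)" for v
    by (rule Ck_on_cong[OF assms(2) _ Suc.IH[of "\<lambda>x. fderiv f x v"]])
      (use Suc.prems in \<open>auto simp: c(2)\<close>)
  then show ?case using Suc.prems by (simp add: c(1))
qed

lemma Ck_on_add:
  assumes "open S"
  shows "Ck_on k S f \<Longrightarrow> Ck_on k S g \<Longrightarrow> Ck_on k S (\<lambda>x. f x + g x)"
proof (induction k arbitrary: f g)
  case 0
  then show ?case by (simp add: continuous_on_add)
next
  case (Suc k)
  have *: "((\<lambda>x. f x + g x) has_derivative (\<lambda>v. fderiv f x v + fderiv g x v)) (at x)"
    if "x \<in> S" for x
    using Suc.prems that by (intro has_derivative_add has_derivative_fderiv) auto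
  have "Ck_on k S (\<lambda>x. fderiv (\<lambda>x. f x + g x) x v)" for v
    by (rule Ck_on_cong[OF assms _ Suc.IH[of "\<lambda>x. fderiv f x v" "\<lambda>x. fderiv g x v"]])
      (use Suc.prems fderiv_eqI[OF *] in auto)
  then show ?case using * by (auto simp: differentiable_def)
qed

lemma Ck_on_sum:
  assumes "open S" "\<And>i. i \<in> I \<Longrightarrow> Ck_on k S (f i)"
  shows "Ck_on k S (\<lambda>x. \<Sum>i\<in>I. f i x)"
  using assms(2)
  by (induction I rule: infinite_finite_induct) (auto simp: Ck_on_const intro!: Ck_on_add assms(1))

lemma Ck_on_bounded_bilinear:
  assumes "bounded_bilinear B" "open S"
  shows "Ck_on k S f \<Longrightarrow> Ck_on k S g \<Longrightarrow> Ck_on k S (\<lambda>x. B (f x) (g x))"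
proof (induction k arbitrary: f g)
  case 0
  then show ?case using bounded_bilinear.continuous_on[OF assms(1)] by auto
next
  case (Suc k)
  note c = fderiv_bounded_bilinear[OF assms(1)]
  have 1: "Ck_on k S f" "Ck_on k S g" using Suc.prems Ck_on_Suc_imp by blast+
  have "Ck_on k S (\<lambda>x. B (f x) (fderiv g x v) + B (fderiv f x v) (g x))" for v
    by (intro Ck_on_add Suc.IH assms 1) (use Suc.prems in auto)
  then have "Ck_on k S (\<lambda>x. fderiv (\<lambda>x. B (f x) (g x)) x v)" for v
    by (rule Ck_on_cong[OF assms(2), rotated]) (use Suc.prems in \<open>simp add: c(2)\<close>)
  then show ?case using Suc.prems by (simp add: c(1))
qed

text \<open>Serves to handle a derivative whose direction varies with the point: the direction
  becomes scalar coefficients in front of derivatives in fixed directions.\<close>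

lemma linear_euclidean_expand:
  fixes L :: "'a::euclidean_space \<Rightarrow> 'b::real_vector"
  assumes "linear L"
  shows "L x = (\<Sum>b\<in>Basis. (x \<bullet> b) *\<^sub>R L b)"
proof -
  have "L x = L (\<Sum>b\<in>Basis. (x \<bullet> b) *\<^sub>R b)" by (simp add: euclidean_representation)
  also have "\<dots> = (\<Sum>b\<in>Basis. (x \<bullet> b) *\<^sub>R L b)"
    by (subst linear_sum[OF assms]) (simp add: linear_cmul[OF assms])
  finally show ?thesis .
qed

lemma fderiv_compose:
  fixes f :: "'a::euclidean_space \<Rightarrow> 'c::euclidean_space"
  assumes "f differentiable (at x)" "g differentiable (at (f x))"
  shows "(\<lambda>x. g (f x)) differentiable (at x)"
    and "fderiv (\<lambda>x. g (f x)) x v = fderiv g (f x) (fderiv f x v)"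
proof -
  have *: "((\<lambda>x. g (f x)) has_derivative (\<lambda>v. fderiv g (f x) (fderiv f x v))) (at x)"
    by (rule has_derivative_compose[OF has_derivative_fderiv[OF assms(1)] has_derivative_fderiv[OF assms(2)]])
  show "(\<lambda>x. g (f x)) differentiable (at x)" using * unfolding differentiable_def by blast
  show "fderiv (\<lambda>x. g (f x)) x v = fderiv g (f x) (fderiv f x v)"
    using fderiv_eqI[OF *] by simp
qed

lemma Ck_on_compose:
  fixes f :: "'a::euclidean_space \<Rightarrow> 'c::euclidean_space"
    and g :: "'c \<Rightarrow> 'b::real_normed_vector"
  assumes S: "open S" and im: "f ` S \<subseteq> T" and f: "Ck_on k S f"
  shows "Ck_on k T g \<Longrightarrow> Ck_on k S (\<lambda>x. g (f x))"
  using f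
proof (induction k arbitrary: g)
  case 0
  then show ?case using im continuous_on_compose2[of T g S f] by auto
next
  case (Suc k)
  have df: "f differentiable (at x)" and dg: "g differentiable (at (f x))" if "x \<in> S" for x
    using Suc.prems im that by auto
  note c = fderiv_compose[OF df dg]
  \<comment> \<open>The direction \<open>fderiv f x v\<close> depends on \<open>x\<close>. After the
    expansion only derivatives of \<open>g\<close> in fixed directions, composed with
    \<open>f\<close>, remain; the induction hypothesis, general in \<open>g\<close>, covers
    them.\<close>
  have e: "fderiv (\<lambda>x. g (f x)) x v = (\<Sum>b\<in>Basis. (fderiv f x v \<bullet> b) *\<^sub>R fderiv g (f x) b)"
    if "x \<in> S" for x v
    unfolding c(2)[OF that that]
    by (rule linear_euclidean_expand[OF linear_frechet_derivative[OF dg[OF that]]])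
  have f1: "Ck_on k S f" using Suc.prems Ck_on_Suc_imp by blast
  have "Ck_on k S (\<lambda>x. \<Sum>b\<in>Basis. (fderiv f x v \<bullet> b) *\<^sub>R fderiv g (f x) b)" for v
    by (intro Ck_on_sum[OF S] Ck_on_bounded_bilinear[OF bounded_bilinear_scaleR S]
        Ck_on_bounded_linear_compose[OF bounded_linear_inner_left S] Suc.IH[OF _ f1])
      (use Suc.prems in auto)
  then have "Ck_on k S (\<lambda>x. fderiv (\<lambda>x. g (f x)) x v)" for v
    by (rule Ck_on_cong[OF S, rotated]) (simp add: e)
  then show ?case using c(1) by simp
qed

lemma Ck_on_Pair:
  fixes f :: "'a::euclidean_space \<Rightarrow> 'b::real_normed_vector"
    and g :: "'a \<Rightarrow> 'c::real_normed_vector"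
  assumes "open S" "Ck_on k S f" "Ck_on k S g"
  shows "Ck_on k S (\<lambda>x. (f x, g x))"
proof -
  have L: "bounded_linear (\<lambda>y::'b. (y, 0::'c))" "bounded_linear (\<lambda>y::'c. (0::'b, y))"
    by (simp_all add: bounded_linear_Pair)
  have "Ck_on k S (\<lambda>x. (f x, 0::'c) + (0::'b, g x))"
    by (intro Ck_on_add assms Ck_on_bounded_linear_compose[OF L(1)]
        Ck_on_bounded_linear_compose[OF L(2)])
  then show ?thesis by simp
qed

section \<open>Second derivatives and their symmetry\<close>

lemma Ck_on_2D:
  assumes "Ck_on 2 S f" "x \<in> S"
  shows "f differentiable (at x)" "(\<lambda>y. fderiv f y v) differentiable (at x)"
    "continuous_on S (\<lambda>y. second_deriv f y u v)"
proof -
  have "Ck_on (Suc (Suc 0)) S f" using assms(1) by (simp only: numeral_2_eq_2)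
  then show "f differentiable (at x)" "(\<lambda>y. fderiv f y v) differentiable (at x)"
    "continuous_on S (\<lambda>y. second_deriv f y u v)"
    using assms(2) by (auto simp: second_deriv_def)
qed

text \<open>Both functions have the same derivatives at \<open>x\<close> in the sense of
  \<open>has_derivative\<close>, so the choice operator behind \<open>frechet_derivative\<close>
  returns the same value for both, differentiable or not.\<close>

lemma fderiv_cong_open:
  assumes "open S" "x \<in> S" "\<And>y. y \<in> S \<Longrightarrow> f y = g y"
  shows "fderiv f x = fderiv g x"
proof -
  have "(f has_derivative F) (at x) \<longleftrightarrow> (g has_derivative F) (at x)" for F
    using has_derivative_transform_within_open[OF _ assms(1,2), of f F UNIV g]
      has_derivative_transform_within_open[OF _ assms(1,2), of g F UNIV f] assms(3) by auto
  then show ?thesis unfolding frechet_derivative_def by simp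
qed

text \<open>Linearity in the outer direction is that of a single derivative. For the inner
  direction, linearity of \<open>fderiv f y\<close> at all \<open>y\<close> near \<open>x\<close> is
  differentiated in \<open>y\<close>.\<close>

lemma linear_second_deriv:
  assumes "open S" "Ck_on 2 S f" "x \<in> S"
  shows "linear (\<lambda>u. second_deriv f x u v)" "linear (second_deriv f x u)"
proof -
  note d = Ck_on_2D[OF assms(2)]
  show "linear (\<lambda>u. second_deriv f x u v)"
    unfolding second_deriv_def by (rule linear_frechet_derivative[OF d(2)[OF assms(3)]])
  have 1: "linear (fderiv f y)" if "y \<in> S" for y
    using linear_frechet_derivative[OF d(1)[OF that]] .
  show "linear (second_deriv f x u)"
  proof (rule linearI)
    fix v w :: 'a and c :: real
    have "fderiv (\<lambda>y. fderiv f y (v + w)) x = fderiv (\<lambda>y. fderiv f y v + fderiv f y w) x"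
      by (rule fderiv_cong_open[OF assms(1,3)]) (simp add: linear_add[OF 1])
    also have "\<dots> = (\<lambda>u. fderiv (\<lambda>y. fderiv f y v) x u + fderiv (\<lambda>y. fderiv f y w) x u)"
      by (rule fderiv_eqI[OF has_derivative_add[OF has_derivative_fderiv has_derivative_fderiv]])
        (rule d(2)[OF assms(3)])+
    finally show "second_deriv f x u (v + w) = second_deriv f x u v + second_deriv f x u w"
      by (simp add: second_deriv_def)
    have "fderiv (\<lambda>y. fderiv f y (c *\<^sub>R v)) x = fderiv (\<lambda>y. c *\<^sub>R fderiv f y v) x"
      by (rule fderiv_cong_open[OF assms(1,3)]) (simp add: linear_cmul[OF 1])
    also have "\<dots> = (\<lambda>u. c *\<^sub>R fderiv (\<lambda>y. fderiv f y v) x u)"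
      by (rule fderiv_eqI[OF has_derivative_scaleR_right[OF has_derivative_fderiv]])
        (rule d(2)[OF assms(3)])
    finally show "second_deriv f x u (c *\<^sub>R v) = c *\<^sub>R second_deriv f x u v"
      by (simp add: second_deriv_def)
  qed
qed

text \<open>The second difference of \<open>f\<close> on the parallelogram spanned by \<open>t u\<close> and \<open>t v\<close> is, by two mean
  value steps, \<open>t\<^sup>2\<close> times a mixed second derivative nearby, in either order.\<close>

lemma second_difference_mean_value:
  fixes f :: "'a::euclidean_space \<Rightarrow> real"
  assumes S: "open S" "Ck_on 2 S f" and t: "0 < t"
    and box: "\<And>s r. 0 \<le> s \<Longrightarrow> s \<le> t \<Longrightarrow> 0 \<le> r \<Longrightarrow> r \<le> t \<Longrightarrow> x + s *\<^sub>R u + r *\<^sub>R v \<in> S"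
  obtains s r where "0 < s" "s < t" "0 < r" "r < t"
    "f (x + t *\<^sub>R u + t *\<^sub>R v) - f (x + t *\<^sub>R u) - f (x + t *\<^sub>R v) + f x
      = t\<^sup>2 * second_deriv f (x + s *\<^sub>R u + r *\<^sub>R v) v u"
proof -
  note d = Ck_on_2D[OF S(2)]
  have chain: "((\<lambda>s. h (a + s *\<^sub>R w)) has_real_derivative fderiv h (a + s *\<^sub>R w) w) (at s)"
    if "h differentiable (at (a + s *\<^sub>R w))" for h :: "'a \<Rightarrow> real" and a w s
  proof -
    have "((\<lambda>s. a + s *\<^sub>R w) has_derivative (\<lambda>s. s *\<^sub>R w)) (at s)"
      by (auto intro!: derivative_eq_intros)
    from has_derivative_compose[OF this has_derivative_fderiv[OF that]]
    have "((\<lambda>s. h (a + s *\<^sub>R w)) has_derivative (\<lambda>k. fderiv h (a + s *\<^sub>R w) (k *\<^sub>R w))) (at s)" .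
    moreover have "(\<lambda>k. fderiv h (a + s *\<^sub>R w) (k *\<^sub>R w)) = (*) (fderiv h (a + s *\<^sub>R w) w)"
      by (simp add: fun_eq_iff linear_cmul[OF linear_frechet_derivative[OF that]])
    ultimately show ?thesis by (simp add: has_field_derivative_def)
  qed
  \<comment> \<open>The increment of \<open>f\<close> along \<open>t v\<close>, as a function of the
    position on the line in direction \<open>u\<close>. The second difference is
    \<open>g t - g 0\<close>; the first mean value step moves along \<open>u\<close>, the second
    along \<open>v\<close>.\<close>
  define g where "g s = f (x + t *\<^sub>R v + s *\<^sub>R u) - f (x + s *\<^sub>R u)" for s
  have inS: "x + t *\<^sub>R v + s *\<^sub>R u \<in> S" "x + s *\<^sub>R u \<in> S" if "0 \<le> s" "s \<le> t" for s
    using box[OF that, of t] box[OF that, of 0] t by (auto simp: algebra_simps)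
  have "(g has_real_derivative
      fderiv f (x + t *\<^sub>R v + s *\<^sub>R u) u - fderiv f (x + s *\<^sub>R u) u) (at s)"
    if "0 \<le> s" "s \<le> t" for s
    unfolding g_def using inS[OF that] by (intro DERIV_diff chain d(1)) auto
  from MVT2[OF t this] obtain s where s: "0 < s" "s < t" and
    g: "g t - g 0 = (t - 0) * (fderiv f (x + t *\<^sub>R v + s *\<^sub>R u) u - fderiv f (x + s *\<^sub>R u) u)"
    by blast
  have "((\<lambda>r. fderiv f (x + s *\<^sub>R u + r *\<^sub>R v) u) has_real_derivative
      second_deriv f (x + s *\<^sub>R u + r *\<^sub>R v) v u) (at r)" if "0 \<le> r" "r \<le> t" for r
    unfolding second_deriv_def using s that
    by (intro chain[of "\<lambda>y. fderiv f y u"] d(2) box) auto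
  from MVT2[OF t this] obtain r where r: "0 < r" "r < t" and
    h: "fderiv f (x + s *\<^sub>R u + t *\<^sub>R v) u - fderiv f (x + s *\<^sub>R u + 0 *\<^sub>R v) u
      = (t - 0) * second_deriv f (x + s *\<^sub>R u + r *\<^sub>R v) v u"
    by blast
  have "f (x + t *\<^sub>R u + t *\<^sub>R v) - f (x + t *\<^sub>R u) - f (x + t *\<^sub>R v) + f x = g t - g 0"
    by (simp add: g_def algebra_simps)
  also have "\<dots> = t * (fderiv f (x + s *\<^sub>R u + t *\<^sub>R v) u - fderiv f (x + s *\<^sub>R u + 0 *\<^sub>R v) u)"
    unfolding g by (simp add: algebra_simps)
  also have "\<dots> = t * (t * second_deriv f (x + s *\<^sub>R u + r *\<^sub>R v) v u)"
    unfolding h by simp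
  finally show ?thesis using that[OF s r] by (simp add: power2_eq_square)
qed

text \<open>Near \<open>x\<close> both mixed derivatives stay within \<epsilon>, half their supposed
  gap, of their values at \<open>x\<close>. The second difference is the same in either order, so
  they take a common value at two points of that neighbourhood, which is impossible.\<close>

lemma second_deriv_symmetric_real:
  fixes f :: "'a::euclidean_space \<Rightarrow> real"
  assumes S: "open S" "Ck_on 2 S f" "x \<in> S"
  shows "second_deriv f x u v = second_deriv f x v u"
proof (rule ccontr)
  assume ne: "\<not> ?thesis"
  define \<epsilon> where "\<epsilon> = \<bar>second_deriv f x u v - second_deriv f x v u\<bar> / 2"
  have \<epsilon>: "\<epsilon> > 0" using ne by (simp add: \<epsilon>_def)
  have near: "\<exists>\<delta>>0. ball x \<delta> \<subseteq> S \<and> (\<forall>y\<in>ball x \<delta>. \<bar>second_deriv f y a b - second_deriv f x a b\<bar> < \<epsilon>)"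
    for a b
  proof -
    have "continuous (at x) (\<lambda>y. second_deriv f y a b)"
      using Ck_on_2D(3)[OF S(2,3)] S by (simp add: continuous_on_eq_continuous_at)
    then obtain \<delta>1 where 1: "\<delta>1 > 0"
      "\<And>y. dist y x < \<delta>1 \<Longrightarrow> dist (second_deriv f y a b) (second_deriv f x a b) < \<epsilon>"
      using \<epsilon> unfolding continuous_at_eps_delta by blast
    obtain \<delta>2 where 2: "\<delta>2 > 0" "ball x \<delta>2 \<subseteq> S" using S openE by blast
    show ?thesis
      by (intro exI[of _ "min \<delta>1 \<delta>2"]) (use 1 2 in \<open>auto simp: dist_commute dist_real_def\<close>)
  qed
  obtain \<delta>1 where 1: "\<delta>1 > 0" "ball x \<delta>1 \<subseteq> S"
    "\<And>y. y \<in> ball x \<delta>1 \<Longrightarrow> \<bar>second_deriv f y u v - second_deriv f x u v\<bar> < \<epsilon>"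
    using near[of u v] by blast
  obtain \<delta>2 where 2: "\<delta>2 > 0" "ball x \<delta>2 \<subseteq> S"
    "\<And>y. y \<in> ball x \<delta>2 \<Longrightarrow> \<bar>second_deriv f y v u - second_deriv f x v u\<bar> < \<epsilon>"
    using near[of v u] by blast
  have swap_uv: "x + r *\<^sub>R v + s *\<^sub>R u = x + s *\<^sub>R u + r *\<^sub>R v" for r s
    by (simp add: add.assoc add.commute)
  \<comment> \<open>Small enough for the parallelogram spanned by \<open>t u\<close> and
    \<open>t v\<close> to lie in both balls. The summand 1 keeps the denominator positive when
    \<open>u = v = 0\<close> and makes the estimate strict.\<close>
  define t where "t = min \<delta>1 \<delta>2 / (norm u + norm v + 1)"
  have np: "norm u + norm v + 1 > 0" by (smt (verit) norm_ge_zero)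
  have t: "t > 0" using 1 2 np by (simp add: t_def)
  have in_ball: "x + s *\<^sub>R u + r *\<^sub>R v \<in> ball x (min \<delta>1 \<delta>2)"
    if "0 \<le> s" "s \<le> t" "0 \<le> r" "r \<le> t" for s r
  proof -
    have "dist (x + (s *\<^sub>R u + r *\<^sub>R v)) x = norm (s *\<^sub>R u + r *\<^sub>R v)"
      by (simp add: dist_norm)
    then have "dist x (x + s *\<^sub>R u + r *\<^sub>R v) = norm (s *\<^sub>R u + r *\<^sub>R v)"
      by (simp add: dist_commute add.assoc)
    also have "\<dots> \<le> s * norm u + r * norm v"
      using norm_triangle_ineq[of "s *\<^sub>R u" "r *\<^sub>R v"] that by simp
    also have "\<dots> \<le> t * norm u + t * norm v" using that by (intro add_mono mult_right_mono) auto
    also have "\<dots> < t * (norm u + norm v + 1)" using t by (simp add: algebra_simps)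
    also have "\<dots> = min \<delta>1 \<delta>2" using np by (simp add: t_def)
    finally show ?thesis by simp
  qed
  obtain s r where sr: "0 < s" "s < t" "0 < r" "r < t"
    "f (x + t *\<^sub>R u + t *\<^sub>R v) - f (x + t *\<^sub>R u) - f (x + t *\<^sub>R v) + f x
      = t\<^sup>2 * second_deriv f (x + s *\<^sub>R u + r *\<^sub>R v) v u"
  proof (rule second_difference_mean_value[OF S(1,2) t, of x u v])
    fix s r :: real
    assume "0 \<le> s" "s \<le> t" "0 \<le> r" "r \<le> t"
    then show "x + s *\<^sub>R u + r *\<^sub>R v \<in> S" using in_ball[of s r] 1(2) by auto
  qed
  obtain s' r' where sr': "0 < s'" "s' < t" "0 < r'" "r' < t"
    "f (x + t *\<^sub>R v + t *\<^sub>R u) - f (x + t *\<^sub>R v) - f (x + t *\<^sub>R u) + f x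
      = t\<^sup>2 * second_deriv f (x + s' *\<^sub>R v + r' *\<^sub>R u) u v"
  proof (rule second_difference_mean_value[OF S(1,2) t, of x v u])
    fix s r :: real
    assume "0 \<le> s" "s \<le> t" "0 \<le> r" "r \<le> t"
    then show "x + s *\<^sub>R v + r *\<^sub>R u \<in> S"
      unfolding swap_uv using in_ball[of r s] 1(2) by auto
  qed
  have "t\<^sup>2 * second_deriv f (x + s *\<^sub>R u + r *\<^sub>R v) v u
      = t\<^sup>2 * second_deriv f (x + s' *\<^sub>R v + r' *\<^sub>R u) u v"
    using sr(5) sr'(5) unfolding swap_uv by linarith
  then have "second_deriv f (x + s *\<^sub>R u + r *\<^sub>R v) v u
      = second_deriv f (x + s' *\<^sub>R v + r' *\<^sub>R u) u v" using t by simp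
  moreover have "\<bar>second_deriv f (x + s *\<^sub>R u + r *\<^sub>R v) v u - second_deriv f x v u\<bar> < \<epsilon>"
    using in_ball[of s r] sr by (intro 2(3)) auto
  moreover have "\<bar>second_deriv f (x + s' *\<^sub>R v + r' *\<^sub>R u) u v - second_deriv f x u v\<bar> < \<epsilon>"
    unfolding swap_uv using in_ball[of r' s'] sr' by (intro 1(3)) auto
  ultimately show False unfolding \<epsilon>_def by argo
qed

lemma second_deriv_inner:
  fixes f :: "'a::euclidean_space \<Rightarrow> 'b::euclidean_space"
  assumes S: "open S" "Ck_on 2 S f" "x \<in> S"
  shows "second_deriv (\<lambda>y. f y \<bullet> b) x u v = second_deriv f x u v \<bullet> b"
proof -
  note d = Ck_on_2D[OF S(2)]
  have "second_deriv (\<lambda>y. f y \<bullet> b) x u v = fderiv (\<lambda>y. fderiv f y v \<bullet> b) x u"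
    unfolding second_deriv_def
    by (rule arg_cong[of _ _ "\<lambda>F. F u"], rule fderiv_cong_open[OF S(1,3)])
      (simp add: fderiv_bounded_linear_compose(2)[OF bounded_linear_inner_left d(1)])
  also have "\<dots> = second_deriv f x u v \<bullet> b"
    by (simp add: second_deriv_def
        fderiv_bounded_linear_compose(2)[OF bounded_linear_inner_left d(2)] S(3))
  finally show ?thesis .
qed

text \<open>The mean value argument is for real-valued functions; the general case follows by
  components.\<close>

lemma second_deriv_symmetric:
  fixes f :: "'a::euclidean_space \<Rightarrow> 'b::euclidean_space"
  assumes S: "open S" "Ck_on 2 S f" "x \<in> S"
  shows "second_deriv f x u v = second_deriv f x v u"
proof (rule euclidean_eqI)
  fix b :: 'b
  have "Ck_on 2 S (\<lambda>y. f y \<bullet> b)"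
    by (rule Ck_on_bounded_linear_compose[OF bounded_linear_inner_left S(1,2)])
  from second_deriv_symmetric_real[OF S(1) this S(3), of u v]
  show "second_deriv f x u v \<bullet> b = second_deriv f x v u \<bullet> b"
    by (simp add: second_deriv_inner[OF S])
qed

text \<open>Covers the chain rule for second derivatives (\<open>X w = D\<phi>\<^sub>w(v)\<close>) as well as derivatives along
  non-constant vector fields (\<open>\<phi> = id\<close>).\<close>

lemma fderiv_of_fderiv_along:
  fixes h :: "'a::euclidean_space \<Rightarrow> 'b::real_normed_vector"
    and \<phi> X :: "'c::euclidean_space \<Rightarrow> 'a"
  assumes S: "open S" "Ck_on 2 S h" and z: "\<phi> z \<in> S"
    and \<phi>: "\<phi> differentiable (at z)" and X: "X differentiable (at z)"
  shows "fderiv (\<lambda>w. fderiv h (\<phi> w) (X w)) z v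
    = second_deriv h (\<phi> z) (fderiv \<phi> z v) (X z) + fderiv h (\<phi> z) (fderiv X z v)"
proof -
  note d = Ck_on_2D[OF S(2)]
  have "isCont \<phi> z" using \<phi> by (rule differentiable_imp_continuous_within)
  then have "\<exists>V. open V \<and> z \<in> V \<and> (\<forall>w\<in>V. \<phi> w \<in> S)"
    using S(1) z by (simp add: continuous_at_open)
  then obtain V where V: "open V" "z \<in> V" "\<And>w. w \<in> V \<Longrightarrow> \<phi> w \<in> S"
    by blast
  have lin: "linear (fderiv h y)" if "y \<in> S" for y
    using linear_frechet_derivative[OF d(1)[OF that]] .
  \<comment> \<open>Expanding \<open>X w\<close> in the basis turns the expression into a sum of
    products, to which the ordinary product and chain rules apply; at the end the sums are
    contracted again.\<close>
  have "fderiv (\<lambda>w. fderiv h (\<phi> w) (X w)) z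
      = fderiv (\<lambda>w. \<Sum>b\<in>Basis. (X w \<bullet> b) *\<^sub>R fderiv h (\<phi> w) b) z"
    by (rule fderiv_cong_open[OF V(1,2)]) (rule linear_euclidean_expand[OF lin[OF V(3)]])
  also have "\<dots> = (\<lambda>v. \<Sum>b\<in>Basis. (X z \<bullet> b) *\<^sub>R second_deriv h (\<phi> z) (fderiv \<phi> z v) b
      + (fderiv X z v \<bullet> b) *\<^sub>R fderiv h (\<phi> z) b)"
    unfolding second_deriv_def
    by (intro fderiv_eqI has_derivative_sum has_derivative_scaleR has_derivative_inner_left
        has_derivative_fderiv X
        has_derivative_compose[OF has_derivative_fderiv[OF \<phi>] has_derivative_fderiv[OF d(2)[OF z]]])
  finally have "fderiv (\<lambda>w. fderiv h (\<phi> w) (X w)) z v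
      = (\<Sum>b\<in>Basis. (X z \<bullet> b) *\<^sub>R second_deriv h (\<phi> z) (fderiv \<phi> z v) b
      + (fderiv X z v \<bullet> b) *\<^sub>R fderiv h (\<phi> z) b)" by simp
  also have "\<dots> = second_deriv h (\<phi> z) (fderiv \<phi> z v) (X z) + fderiv h (\<phi> z) (fderiv X z v)"
    using linear_euclidean_expand[OF linear_second_deriv(2)[OF S z], of "fderiv \<phi> z v" "X z"]
      linear_euclidean_expand[OF lin[OF z], of "fderiv X z v"]
    by (simp add: sum.distrib)
  finally show ?thesis .
qed

lemma second_deriv_compose:
  fixes h :: "'a::euclidean_space \<Rightarrow> 'b::real_normed_vector"
    and \<phi> :: "'c::euclidean_space \<Rightarrow> 'a"
  assumes S: "open S" "Ck_on 2 S h" and T: "open T" "Ck_on 2 T \<phi>" "\<phi> ` T \<subseteq> S" and z: "z \<in> T"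
  shows "second_deriv (\<lambda>w. h (\<phi> w)) z u v
    = second_deriv h (\<phi> z) (fderiv \<phi> z u) (fderiv \<phi> z v) + fderiv h (\<phi> z) (second_deriv \<phi> z u v)"
proof -
  note dh = Ck_on_2D[OF S(2)] and d\<phi> = Ck_on_2D[OF T(2)]
  have "second_deriv (\<lambda>w. h (\<phi> w)) z u v = fderiv (\<lambda>w. fderiv h (\<phi> w) (fderiv \<phi> w v)) z u"
    unfolding second_deriv_def
    by (rule arg_cong[of _ _ "\<lambda>F. F u"], rule fderiv_cong_open[OF T(1) z])
      (use T in \<open>auto intro!: fderiv_compose(2) dh d\<phi>\<close>)
  also have "\<dots> = second_deriv h (\<phi> z) (fderiv \<phi> z u) (fderiv \<phi> z v)
      + fderiv h (\<phi> z) (second_deriv \<phi> z u v)"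
    unfolding second_deriv_def[of \<phi>]
    by (rule fderiv_of_fderiv_along[OF S]) (use T z d\<phi> in auto)
  finally show ?thesis .
qed

section \<open>Inner products and orthonormal families\<close>

lemma inner_product_induced:
  assumes "linear L" "inj L"
  shows "inner_product (\<lambda>u v. L u \<bullet> (L v::'b::real_inner))"
  unfolding inner_product_def bilinear_def
proof (intro conjI allI impI)
  fix u v :: 'a
  show "linear (\<lambda>v. L u \<bullet> L v)" "linear (\<lambda>u. L u \<bullet> L v)"
    by (auto intro!: linearI simp: linear_add[OF assms(1)] linear_cmul[OF assms(1)] inner_simps)
  show "L u \<bullet> L v = L v \<bullet> L u" by (rule inner_commute)
  show "L u \<bullet> L u > 0" if "u \<noteq> 0"
    using that linear_injective_0[OF assms(1)] assms(2) by auto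
qed

text \<open>Pairing with \<open>a j\<close> recovers the coefficient at \<open>j\<close>, so the
  family is independent; having as many members as the dimension, it spans.\<close>

lemma orthonormal_family_expand:
  fixes G :: "'e::euclidean_space \<Rightarrow> 'e \<Rightarrow> real"
  assumes G: "inner_product G" and I: "finite I" "card I = DIM('e)"
    and a: "\<And>i j. i \<in> I \<Longrightarrow> j \<in> I \<Longrightarrow> G (a i) (a j) = (if i = j then 1 else 0)"
  shows "v = (\<Sum>i\<in>I. G v (a i) *\<^sub>R a i)"
proof -
  have lin: "linear (\<lambda>u. G u w)" for w using G by (simp add: inner_product_def bilinear_def)
  have coeff: "G (\<Sum>i\<in>I. c i *\<^sub>R a i) (a j) = c j" if "j \<in> I" for c j
  proof -
    have "G (\<Sum>i\<in>I. c i *\<^sub>R a i) (a j) = (\<Sum>i\<in>I. c i * (if i = j then 1 else 0))"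
      by (simp add: linear_sum[OF lin] linear_cmul[OF lin] a that)
    also have "\<dots> = c j" using I that by (simp add: if_distrib cong: if_cong)
    finally show ?thesis .
  qed
  have inj: "inj_on a I" by (rule inj_onI) (metis a zero_neq_one)
  have "independent (a ` I)"
  proof (rule independent_if_scalars_zero)
    fix c x assume c: "(\<Sum>x\<in>a ` I. c x *\<^sub>R x) = 0" and "x \<in> a ` I"
    then obtain j where j: "j \<in> I" "x = a j" by blast
    have "(\<Sum>i\<in>I. c (a i) *\<^sub>R a i) = 0" using c by (simp add: sum.reindex[OF inj])
    then show "c x = 0" using coeff[OF j(1), of "\<lambda>i. c (a i)"] j(2) linear_0[OF lin] by simp
  qed (simp add: I)
  then have "v \<in> span (a ` I)"
    using card_ge_dim_independent[of "a ` I" UNIV] I by (auto simp: card_image[OF inj])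
  then obtain c where c: "v = (\<Sum>x\<in>a ` I. c x *\<^sub>R x)" using I by (auto simp: span_finite)
  then have "v = (\<Sum>i\<in>I. c (a i) *\<^sub>R a i)" by (simp add: sum.reindex[OF inj])
  moreover have "c (a j) = G v (a j)" if "j \<in> I" for j
    unfolding calculation by (rule coeff[OF that, symmetric])
  ultimately show ?thesis by simp
qed

text \<open>Expand \<open>a i\<close> in the family \<open>b\<close>, exchange the sums, and
  recognise the expansion of \<open>b j\<close> in the family \<open>a\<close>. This lets an
  arbitrary orthonormal frame be replaced by one adapted to the product.\<close>

lemma trace_orthonormal_family_eq:
  fixes G :: "'e::euclidean_space \<Rightarrow> 'e \<Rightarrow> real" and Q :: "'e \<Rightarrow> 'e \<Rightarrow> 'w::real_vector"
  assumes G: "inner_product G" and Q: "bilinear Q"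
    and I: "finite I" "card I = DIM('e)"
      "\<And>i j. i \<in> I \<Longrightarrow> j \<in> I \<Longrightarrow> G (a i) (a j) = (if i = j then 1 else 0)"
    and J: "finite J" "card J = DIM('e)"
      "\<And>i j. i \<in> J \<Longrightarrow> j \<in> J \<Longrightarrow> G (b i) (b j) = (if i = j then 1 else 0)"
  shows "(\<Sum>i\<in>I. Q (a i) (a i)) = (\<Sum>j\<in>J. Q (b j) (b j))"
proof -
  have Ql: "linear (\<lambda>u. Q u w)" and Qr: "linear (Q w)" for w
    using Q by (simp_all add: bilinear_def)
  have sym: "G u w = G w u" for u w using G by (simp add: inner_product_def)
  have "(\<Sum>i\<in>I. Q (a i) (a i)) = (\<Sum>i\<in>I. Q (\<Sum>j\<in>J. G (a i) (b j) *\<^sub>R b j) (a i))"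
    by (intro sum.cong refl arg_cong[of _ _ "\<lambda>u. Q u _"] orthonormal_family_expand[OF G J])
  also have "\<dots> = (\<Sum>j\<in>J. \<Sum>i\<in>I. G (b j) (a i) *\<^sub>R Q (b j) (a i))"
    by (subst sum.swap) (simp add: linear_sum[OF Ql] linear_cmul[OF Ql] sym)
  also have "\<dots> = (\<Sum>j\<in>J. Q (b j) (\<Sum>i\<in>I. G (b j) (a i) *\<^sub>R a i))"
    by (simp add: linear_sum[OF Qr] linear_cmul[OF Qr])
  also have "\<dots> = (\<Sum>j\<in>J. Q (b j) (b j))"
    by (intro sum.cong refl arg_cong[of _ _ "Q _"] orthonormal_family_expand[OF G I, symmetric])
  finally show ?thesis .
qed

text \<open>An orthonormal basis of the range of \<open>L\<close> is pulled back by
  \<open>inv L\<close>; it is orthonormal for the metric that \<open>L\<close> induces.\<close>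

lemma orthonormal_preimage_exists:
  fixes L :: "'e::euclidean_space \<Rightarrow> 'w::euclidean_space"
  assumes "linear L" "inj L"
  obtains C where "finite C" "card C = DIM('e)"
    "\<And>c d. c \<in> C \<Longrightarrow> d \<in> C \<Longrightarrow> L c \<bullet> L d = (if c = d then 1 else 0)"
proof -
  obtain B where B: "B \<subseteq> range L" "pairwise orthogonal B" "\<And>x. x \<in> B \<Longrightarrow> norm x = 1"
    "independent B" "card B = dim (range L)"
    using orthonormal_basis_subspace[OF linear_subspace_image[OF assms(1) subspace_UNIV]] by metis
  have "inj_on (inv L) B" by (rule inj_on_subset[OF inj_on_inv_into B(1)]) simp
  then have card: "card (inv L ` B) = DIM('e)"
    using B(5) dim_image_eq[OF assms(1), of UNIV] assms(2) by (simp add: card_image)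
  show ?thesis
  proof (rule that[OF _ card])
    show "finite (inv L ` B)" using B(4) independent_imp_finite by blast
    fix c d assume "c \<in> inv L ` B" "d \<in> inv L ` B"
    then obtain x y where xy: "x \<in> B" "y \<in> B" "c = inv L x" "d = inv L y" by blast
    then have L: "L c = x" "L d = y" using B(1) by (auto simp: f_inv_into_f)
    show "L c \<bullet> L d = (if c = d then 1 else 0)"
    proof (cases "x = y")
      case True
      then show ?thesis using xy L B(3)[of x] by (simp add: dot_square_norm)
    next
      case False
      then have "c \<noteq> d" using L by auto
      then show ?thesis using False xy L B(2) by (simp add: pairwise_def orthogonal_def)
    qed
  qed
qed

text \<open>The least squares solution: \<open>P\<close> is the inverse of
  \<open>adjoint L \<circ> L\<close>, applied after \<open>adjoint L\<close>. The map inverted is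
  injective because its value 0 at \<open>x\<close> forces
  \<open>L x \<bullet> L x = 0\<close>.\<close>

lemma tangential_projection_exists:
  fixes L :: "'e::euclidean_space \<Rightarrow> 'w::euclidean_space"
  assumes "linear L" "inj L"
  obtains P where "linear P" "\<And>w v. (w - L (P w)) \<bullet> L v = 0"
proof -
  define A where "A = adjoint L \<circ> L"
  have ladj: "linear (adjoint L)" by (rule adjoint_linear[OF assms(1)])
  have A: "linear A" unfolding A_def by (rule linear_compose[OF assms(1) ladj])
  have adj: "x \<bullet> adjoint L y = L x \<bullet> y" for x y by (rule adjoint_works[OF assms(1)])
  have injA: "inj A"
    unfolding linear_injective_0[OF A]
  proof (intro allI impI)
    fix x assume "A x = 0"
    then have "L x \<bullet> L x = 0" using adj[of x "L x"] by (simp add: A_def)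
    then show "x = 0" using linear_injective_0[OF assms(1)] assms(2) by simp
  qed
  have surj: "A (inv A x) = x" for x
    using linear_injective_imp_surjective[OF A injA] by (simp add: surj_f_inv_f)
  have linv: "linear (inv A)" by (rule inj_linear_imp_inv_linear[OF A injA])
  show ?thesis
  proof (rule that[of "inv A \<circ> adjoint L"])
    show "linear (inv A \<circ> adjoint L)" by (rule linear_compose[OF ladj linv])
    fix w v
    have "L ((inv A \<circ> adjoint L) w) \<bullet> L v = v \<bullet> adjoint L w"
      using adj[of v "L (inv A (adjoint L w))"] surj[of "adjoint L w"]
      by (simp add: A_def inner_commute)
    then show "(w - L ((inv A \<circ> adjoint L) w)) \<bullet> L v = 0"
      using adj[of v w] by (simp add: inner_diff_left inner_diff_right inner_commute)
  qed
qed

text \<open>A dimension count. The range of \<open>L\<close> is a hyperplane with normal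
  \<open>x\<close>; if the part \<open>t\<close> of \<open>s\<close> orthogonal to \<open>x\<close>
  were nonzero, then \<open>t\<close> and \<open>x\<close> would add two dimensions to the range,
  one more than there is room for.\<close>

lemma orthogonal_to_hyperplane_eq:
  fixes L :: "'e::euclidean_space \<Rightarrow> 'e \<times> real"
  assumes L: "linear L" "inj L" and x: "x \<noteq> 0" "\<And>v. x \<bullet> L v = 0" and s: "\<And>v. s \<bullet> L v = 0"
  shows "s = ((s \<bullet> x) / (x \<bullet> x)) *\<^sub>R x"
proof (rule ccontr)
  define t where "t = s - ((s \<bullet> x) / (x \<bullet> x)) *\<^sub>R x"
  assume "\<not> ?thesis"
  then have t: "t \<noteq> 0" by (simp add: t_def)
  have tx: "t \<bullet> x = 0" using x(1) by (simp add: t_def inner_diff_left)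
  then have "t \<noteq> x" using x(1) by auto
  have "independent {t, x}"
    using tx t x(1) by (intro pairwise_orthogonal_independent)
      (auto simp: pairwise_def orthogonal_def inner_commute)
  then have "dim {t, x} = 2" using \<open>t \<noteq> x\<close> by (simp add: dim_eq_card_independent)
  moreover have "dim (range L) = DIM('e)"
    using dim_image_eq[OF L(1), of UNIV] L(2) by simp
  moreover have "dim (range L \<union> {t, x}) = dim (range L) + dim {t, x}"
    by (rule dim_orthogonal_sum)
      (use x(2) s in \<open>auto simp: t_def inner_diff_left inner_diff_right inner_commute\<close>)
  moreover have "dim (range L \<union> {t, x}) \<le> DIM('e \<times> real)" by (rule dim_subset_UNIV)
  ultimately show False by simp
qed

section \<open>The Levi-Civita connection of an induced metric\<close>

text \<open>Symmetry in the first two arguments and antisymmetry in the last two force a trilinear form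
  to vanish.\<close>

lemma christoffel_eqI:
  assumes g: "inner_product (g y)"
    and \<Gamma>: "bilinear \<Gamma>" "\<And>u v. \<Gamma> u v = \<Gamma> v u"
      "\<And>u v w. fderiv (\<lambda>z. g z v w) y u = g y (\<Gamma> u v) w + g y v (\<Gamma> u w)"
  shows "christoffel g y = \<Gamma>"
  unfolding christoffel_def
proof (rule the_equality)
  show "bilinear \<Gamma> \<and> (\<forall>u v. \<Gamma> u v = \<Gamma> v u) \<and>
     (\<forall>u v w. fderiv (\<lambda>z. g z v w) y u = g y (\<Gamma> u v) w + g y v (\<Gamma> u w))"
    using \<Gamma> by blast
  fix \<Delta> assume \<Delta>: "bilinear \<Delta> \<and> (\<forall>u v. \<Delta> u v = \<Delta> v u) \<and>
     (\<forall>u v w. fderiv (\<lambda>z. g z v w) y u = g y (\<Delta> u v) w + g y v (\<Delta> u w))"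
  have bil: "bilinear (g y)" and sym: "g y u v = g y v u" and pos: "u \<noteq> 0 \<Longrightarrow> g y u u > 0" for u v
    using g by (auto simp: inner_product_def)
  define T where "T u v w = g y (\<Delta> u v - \<Gamma> u v) w" for u v w
  have T1: "T u v w = T v u w" for u v w
    using \<Delta> \<Gamma>(2)[of u v] by (simp add: T_def)
  have T2: "T u v w = - T u w v" for u v w
  proof -
    have "g y (\<Delta> u v) w + g y v (\<Delta> u w) = g y (\<Gamma> u v) w + g y v (\<Gamma> u w)"
      using \<Delta> \<Gamma>(3)[of v w u] by simp
    then show ?thesis
      by (simp add: T_def bilinear_lsub[OF bil] sym[of v])
  qed
  \<comment> \<open>Six alternating applications of \<open>T1\<close> and \<open>T2\<close> return
    to \<open>T u v w\<close>, with three changes of sign.\<close>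
  have "T u v w = 0" for u v w
    using T1[of u v w] T2[of v u w] T1[of v w u] T2[of w v u] T1[of w u v] T2[of u w v] by linarith
  then have "g y (\<Delta> u v - \<Gamma> u v) (\<Delta> u v - \<Gamma> u v) = 0" for u v by (simp add: T_def)
  then have "\<Delta> u v - \<Gamma> u v = 0" for u v using pos by fastforce
  then show "\<Delta> = \<Gamma>" by (simp add: fun_eq_iff)
qed

text \<open>The tangential part of the second derivative of \<iota> is symmetric and compatible with
  \<open>g\<close>, hence equals \<open>christoffel g y\<close> by uniqueness. What remains of the
  second derivative is normal.\<close>

lemma christoffel_induced:
  fixes \<iota> :: "'e::euclidean_space \<Rightarrow> 'w::euclidean_space"
  assumes S: "open S" "Ck_on 2 S \<iota>" and y: "y \<in> S" and inj: "inj (fderiv \<iota> y)"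
    and g: "\<And>z v w. z \<in> S \<Longrightarrow> g z v w = fderiv \<iota> z v \<bullet> fderiv \<iota> z w"
  shows "bilinear (christoffel g y)"
    and "(second_deriv \<iota> y u v - fderiv \<iota> y (christoffel g y u v)) \<bullet> fderiv \<iota> y w = 0"
proof -
  note d = Ck_on_2D[OF S(2)]
  have lin: "linear (fderiv \<iota> y)" by (rule linear_frechet_derivative[OF d(1)[OF y]])
  obtain P where P: "linear P" "\<And>w v. (w - fderiv \<iota> y (P w)) \<bullet> fderiv \<iota> y v = 0"
    using tangential_projection_exists[OF lin inj] by metis
  define \<Gamma> where "\<Gamma> u v = P (second_deriv \<iota> y u v)" for u v
  note l2 = linear_second_deriv[OF S y]
  have bil: "bilinear \<Gamma>" unfolding bilinear_def
  proof (intro conjI allI)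
    fix u
    show "linear (\<Gamma> u)"
      using linear_compose[OF l2(2) P(1)] by (simp add: \<Gamma>_def[abs_def] o_def)
    show "linear (\<lambda>v. \<Gamma> v u)"
      using linear_compose[OF l2(1) P(1)] by (simp add: \<Gamma>_def[abs_def] o_def)
  qed
  have G: "fderiv \<iota> y (\<Gamma> u v) \<bullet> fderiv \<iota> y w = second_deriv \<iota> y u v \<bullet> fderiv \<iota> y w" for u v w
    using P(2)[of "second_deriv \<iota> y u v" w] by (simp add: \<Gamma>_def inner_diff_left)
  have gy: "g y = (\<lambda>v w. fderiv \<iota> y v \<bullet> fderiv \<iota> y w)" using g[OF y] by (simp add: fun_eq_iff)
  have "christoffel g y = \<Gamma>"
  proof (rule christoffel_eqI[OF _ bil])
    show "inner_product (g y)" unfolding gy by (rule inner_product_induced[OF lin inj])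
    show "\<Gamma> u v = \<Gamma> v u" for u v
      unfolding \<Gamma>_def second_deriv_symmetric[OF S y, of u v] ..
    fix u v w
    have "fderiv (\<lambda>z. g z v w) y u = fderiv (\<lambda>z. fderiv \<iota> z v \<bullet> fderiv \<iota> z w) y u"
      by (rule arg_cong[of _ _ "\<lambda>F. F u"], rule fderiv_cong_open[OF S(1) y]) (rule g)
    also have "\<dots> = fderiv \<iota> y v \<bullet> second_deriv \<iota> y u w + second_deriv \<iota> y u v \<bullet> fderiv \<iota> y w"
      unfolding second_deriv_def
      by (rule fderiv_bounded_bilinear(2)[OF bounded_bilinear_inner d(2)[OF y] d(2)[OF y]])
    finally show "fderiv (\<lambda>z. g z v w) y u = g y (\<Gamma> u v) w + g y v (\<Gamma> u w)"
      unfolding gy using G[of u v w] G[of u w v] by (simp add: inner_commute)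
  qed
  then show "bilinear (christoffel g y)"
    "(second_deriv \<iota> y u v - fderiv \<iota> y (christoffel g y u v)) \<bullet> fderiv \<iota> y w = 0"
    using bil G[of u v w] by (simp_all add: inner_diff_left)
qed

section \<open>Immersions of a warped product into Euclidean space\<close>

text \<open>In a warped metric the base coefficients are constant on vertical lines and the fibre
  coefficients on horizontal ones. Equality along one line is thus what is available, and it
  determines the derivative in that direction.\<close>

lemma fderiv_eq_along_line:
  fixes F G :: "'a::real_normed_vector \<Rightarrow> 'b::real_normed_vector"
  assumes S: "open S" "x \<in> S" and d: "F differentiable (at x)" "G differentiable (at x)"
    and eq: "\<And>t. x + t *\<^sub>R v \<in> S \<Longrightarrow> F (x + t *\<^sub>R v) = G (x + t *\<^sub>R v)"
  shows "fderiv F x v = fderiv G x v"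
proof -
  have line: "((\<lambda>t. x + t *\<^sub>R v) has_derivative (\<lambda>t. t *\<^sub>R v)) (at 0)"
    by (auto intro!: derivative_eq_intros)
  have *: "fderiv (\<lambda>t. H (x + t *\<^sub>R v)) 0 1 = fderiv H x v" if "H differentiable (at x)"
    for H :: "'a \<Rightarrow> 'b"
  proof -
    have "(H has_derivative fderiv H x) (at (x + 0 *\<^sub>R v))"
      using has_derivative_fderiv[OF that] by simp
    from fderiv_eqI[OF has_derivative_compose[OF line this]] show ?thesis by simp
  qed
  have "open ((\<lambda>t. x + t *\<^sub>R v) -` S)"
    by (intro open_vimage S continuous_intros)
  then have "fderiv (\<lambda>t. F (x + t *\<^sub>R v)) 0 = fderiv (\<lambda>t. G (x + t *\<^sub>R v)) 0"
    by (rule fderiv_cong_open) (use S eq in auto)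
  then show ?thesis using *[OF d(1)] *[OF d(2)] by simp
qed

text \<open>The partial derivatives of \<open>\<psi>\<close> along a horizontal direction \<open>a\<close> and a vertical direction \<open>b\<close>
  satisfy \<open>\<psi>\<^sub>a\<^sub>a \<bullet> \<psi>\<^sub>b = 0\<close> and \<open>\<psi>\<^sub>a\<^sub>b \<bullet> \<psi>\<^sub>b = (h\<^sub>a / h) \<bar>\<psi>\<^sub>b\<bar>\<^sup>2\<close>.  Differentiating the first along \<open>b\<close> and the
  second along \<open>a\<close> and eliminating \<open>\<psi>\<^sub>a\<^sub>a\<^sub>b\<close> gives the Gauss equation for the plane of \<open>a\<close> and \<open>b\<close>.\<close>

lemma warped_immersion_gauss_inequality:
  fixes \<psi> :: "'a::euclidean_space \<times> 'b::euclidean_space \<Rightarrow> 'w::euclidean_space"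
    and h :: "'a \<times> 'b \<Rightarrow> real"
  assumes \<Omega>: "open \<Omega>" and \<psi>: "Ck_on 3 \<Omega> \<psi>" and h: "Ck_on 2 \<Omega> h" "\<And>y. y \<in> \<Omega> \<Longrightarrow> h y > 0"
    and metric: "\<And>y u v. y \<in> \<Omega> \<Longrightarrow> fderiv \<psi> y u \<bullet> fderiv \<psi> y v
      = gB (fst y) (fst u) (fst v) + (h y)\<^sup>2 * gF (snd y) (snd u) (snd v)"
    and zero: "\<And>y u. y \<in> \<Omega> \<Longrightarrow> gB (fst y) u 0 = 0" "\<And>y u. y \<in> \<Omega> \<Longrightarrow> gB (fst y) 0 u = 0"
      "\<And>y u. y \<in> \<Omega> \<Longrightarrow> gF (snd y) u 0 = 0" "\<And>y u. y \<in> \<Omega> \<Longrightarrow> gF (snd y) 0 u = 0"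
    and z: "z \<in> \<Omega>" and inj: "inj (fderiv \<psi> z)"
    and \<Gamma>a: "\<And>w. (second_deriv \<psi> z (a, 0) (a, 0) - fderiv \<psi> z \<Gamma>a) \<bullet> fderiv \<psi> z w = 0"
    and \<Gamma>b: "\<And>w. (second_deriv \<psi> z (0, b) (0, b) - fderiv \<psi> z \<Gamma>b) \<bullet> fderiv \<psi> z w = 0"
  shows "(fderiv h z \<Gamma>a - second_deriv h z (a, 0) (a, 0)) / h z
      * (fderiv \<psi> z (0, b) \<bullet> fderiv \<psi> z (0, b))
    \<le> (second_deriv \<psi> z (a, 0) (a, 0) - fderiv \<psi> z \<Gamma>a)
      \<bullet> (second_deriv \<psi> z (0, b) (0, b) - fderiv \<psi> z \<Gamma>b)"
proof -
  have \<psi>2: "Ck_on 2 \<Omega> \<psi>" by (rule Ck_on_mono[OF \<psi>]) simp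
  have p2: "Ck_on 2 \<Omega> (\<lambda>y. fderiv \<psi> y u)" for u
  proof -
    have "Ck_on (Suc 2) \<Omega> \<psi>" using \<psi> by (simp only: eval_nat_numeral)
    then show ?thesis unfolding Ck_on.simps by blast
  qed
  define p where "p u y = fderiv \<psi> y u" for u y
  define s where "s u v y = second_deriv \<psi> y u v" for u v y
  have pd: "p u differentiable (at y)" and sd: "s u v differentiable (at y)"
    and dp: "fderiv (p v) y u = s u v y" if "y \<in> \<Omega>" for u v y
    using Ck_on_2D(1,2)[OF p2 that]
    by (simp_all add: p_def[abs_def] s_def[abs_def] second_deriv_def)
  note hd = Ck_on_2D(1,2)[OF h(1)]
  have s_sym: "s u v y = s v u y" if "y \<in> \<Omega>" for u v y
    unfolding s_def by (rule second_deriv_symmetric[OF \<Omega> \<psi>2 that])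
  note prod_rule = fderiv_bounded_bilinear[OF bounded_bilinear_inner]
  have dpp: "(\<lambda>y. p u y \<bullet> p v y) differentiable (at y)"
    "fderiv (\<lambda>y. p u y \<bullet> p v y) y w = p u y \<bullet> s w v y + s w u y \<bullet> p v y"
    if "y \<in> \<Omega>" for u v w y
    using prod_rule[OF pd[OF that] pd[OF that], of u v] by (simp_all add: dp[OF that])
  have hor: "p (a', 0) y \<bullet> p (a'', 0) y = gB (fst y) a' a''"
    and ver: "p (0, b') y \<bullet> p (0, b'') y = (h y)\<^sup>2 * gF (snd y) b' b''"
    and mix: "p (a', 0) y \<bullet> p (0, b') y = 0" if "y \<in> \<Omega>" for a' a'' b' b'' y
    using that by (simp_all add: p_def metric zero)
  \<comment> \<open>Derivative, in an arbitrary direction \<open>w\<close>, of the orthogonality of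
    horizontal and vertical vectors.\<close>
  have HV: "p (a', 0) y \<bullet> s w (0, b') y + s w (a', 0) y \<bullet> p (0, b') y = 0"
    if y: "y \<in> \<Omega>" for a' b' w y
  proof -
    have "fderiv (\<lambda>y. p (a', 0) y \<bullet> p (0, b') y) y = fderiv (\<lambda>y. 0) y"
      by (rule fderiv_cong_open[OF \<Omega> y]) (simp add: mix)
    then show ?thesis using dpp(2)[OF y, of "(a', 0)" "(0, b')" w] by simp
  qed
  \<comment> \<open>The squared length of a horizontal vector depends on the base point alone, so
    its vertical derivative vanishes.\<close>
  have ab_a: "s (0, b') (a', 0) y \<bullet> p (a', 0) y = 0" if y: "y \<in> \<Omega>" for a' b' y
  proof -
    have "fderiv (\<lambda>y. p (a', 0) y \<bullet> p (a', 0) y) y (0, b') = fderiv (\<lambda>_. p (a', 0) y \<bullet> p (a', 0) y) y (0, b')"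
      by (rule fderiv_eq_along_line[OF \<Omega> y dpp(1)[OF y]]) (use y in \<open>auto simp: hor\<close>)
    then show ?thesis using dpp(2)[OF y, of "(a', 0)" "(a', 0)" "(0, b')"] by (simp add: inner_commute)
  qed
  \<comment> \<open>By \<open>HV\<close> and \<open>ab_a\<close>: the horizontal leaves are totally
    geodesic.\<close>
  have aa_b: "s (a', 0) (a', 0) y \<bullet> p (0, b') y = 0" if y: "y \<in> \<Omega>" for a' b' y
    using HV[OF y, of a' "(a', 0)" b'] ab_a[OF y, of b' a'] s_sym[OF y, of "(a', 0)" "(0, b')"]
    by (simp add: inner_commute)
  \<comment> \<open>Along a horizontal line the squared length of a vertical vector is a constant
    \<open>c\<close> times the square of \<open>h\<close>. The relation is kept free of division so
    that the product rule differentiates it directly.\<close>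
  have ab_b: "(s (a', 0) (0, b') y \<bullet> p (0, b') y) * h y = fderiv h y (a', 0) * (p (0, b') y \<bullet> p (0, b') y)"
    if y: "y \<in> \<Omega>" for a' b' y
  proof -
    define c where "c = gF (snd y) b' b'"
    have pp: "p (0, b') y \<bullet> p (0, b') y = c * (h y)\<^sup>2"
      using y by (simp add: ver c_def)
    have hh: "((\<lambda>y. c * (h y)\<^sup>2) has_derivative (\<lambda>w. c * (2 * h y * fderiv h y w))) (at y)"
      by (rule has_derivative_eq_rhs, rule has_derivative_mult_right,
          rule has_derivative_power[OF has_derivative_fderiv[OF hd(1)[OF y]]])
        (simp add: fun_eq_iff)
    have "fderiv (\<lambda>y. p (0, b') y \<bullet> p (0, b') y) y (a', 0) = fderiv (\<lambda>y. c * (h y)\<^sup>2) y (a', 0)"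
      by (rule fderiv_eq_along_line[OF \<Omega> y dpp(1)[OF y]])
        (use hh in \<open>auto simp: differentiable_def ver c_def\<close>)
    then have "s (a', 0) (0, b') y \<bullet> p (0, b') y = c * h y * fderiv h y (a', 0)"
      using dpp(2)[OF y, of "(0, b')" "(0, b')" "(a', 0)"] fderiv_eqI[OF hh] by (simp add: inner_commute)
    then show ?thesis using pp by (simp add: power2_eq_square)
  qed
  define A where "A = (a, 0::'b)"
  define B where "B = (0::'a, b)"
  define U where "U = fderiv (s A A) z B"
  define F where "F = p B z \<bullet> p B z"
  define X where "X = s A B z \<bullet> p B z"
  define c where "c = fderiv h z A / h z"
  have hz: "h z > 0" using h(2) z .
  \<comment> \<open>Third derivatives commute: symmetry is used for \<psi> and then for the map
    \<open>p A\<close>, which is \<open>C\<^sup>2\<close> because \<psi> is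
    \<open>C\<^sup>3\<close>.\<close>
  have U: "fderiv (s A B) z A = U"
  proof -
    have "fderiv (s A B) z = fderiv (\<lambda>y. fderiv (p A) y B) z"
      by (rule fderiv_cong_open[OF \<Omega> z]) (simp add: dp s_sym)
    then have "fderiv (s A B) z A = second_deriv (p A) z A B" by (simp add: second_deriv_def)
    also have "\<dots> = second_deriv (p A) z B A"
      using p2[of A] by (intro second_deriv_symmetric[OF \<Omega> _ z]) (simp add: p_def[abs_def])
    also have "\<dots> = fderiv (s A A) z B"
      unfolding second_deriv_def
      by (rule arg_cong[of _ _ "\<lambda>F. F B"], rule fderiv_cong_open[OF \<Omega> z]) (simp add: dp)
    finally show ?thesis by (simp add: U_def)
  qed
  have XF: "X = c * F"
    using ab_b[OF z, of a b] hz by (simp add: X_def c_def F_def A_def B_def field_simps)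
  have gauss1: "s A A z \<bullet> s B B z + U \<bullet> p B z = 0"
  proof -
    have "fderiv (\<lambda>y. s A A y \<bullet> p B y) z = fderiv (\<lambda>y. 0) z"
      by (rule fderiv_cong_open[OF \<Omega> z]) (simp add: A_def B_def aa_b)
    then show ?thesis
      using prod_rule(2)[OF sd[OF z] pd[OF z], of A A B B] by (simp add: dp[OF z] U_def)
  qed
  \<comment> \<open>The derivative of \<open>ab_b\<close> along \<open>A\<close>. It shares the
    third derivative \<open>U\<close> with \<open>gauss1\<close>, the derivative of
    \<open>aa_b\<close> along \<open>B\<close>; \<open>cross\<close> eliminates it.\<close>
  have gauss2: "(s A B z \<bullet> s A B z + U \<bullet> p B z) * h z + X * fderiv h z A
    = second_deriv h z A A * F + fderiv h z A * (2 * X)"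
  proof -
    have "fderiv (\<lambda>y. (s A B y \<bullet> p B y) * h y) z A
        = fderiv (\<lambda>y. fderiv h y A * (p B y \<bullet> p B y)) z A"
      by (rule arg_cong[of _ _ "\<lambda>F. F A"], rule fderiv_cong_open[OF \<Omega> z]) (simp add: A_def B_def ab_b)
    moreover have "fderiv (\<lambda>y. (s A B y \<bullet> p B y) * h y) z A
        = X * fderiv h z A + (s A B z \<bullet> s A B z + U \<bullet> p B z) * h z"
      using fderiv_bounded_bilinear(2)[OF bounded_bilinear_mult prod_rule(1)[OF sd[OF z] pd[OF z]] hd(1)[OF z]]
        prod_rule(2)[OF sd[OF z] pd[OF z], of A B B A]
      by (simp add: X_def dp[OF z] U)
    moreover have "fderiv (\<lambda>y. fderiv h y A * (p B y \<bullet> p B y)) z A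
        = fderiv h z A * (2 * X) + second_deriv h z A A * F"
      using fderiv_bounded_bilinear(2)[OF bounded_bilinear_mult hd(2)[OF z] dpp(1)[OF z]]
        dpp(2)[OF z, of B B A]
      by (simp add: X_def F_def second_deriv_def inner_commute)
    ultimately show ?thesis by (simp add: algebra_simps)
  qed
  \<comment> \<open>In a warped product the covariant derivative of the lift \<open>B\<close> along
    \<open>A\<close> is \<open>c\<close> times \<open>B\<close>, so this vector is the mixed second
    fundamental form of \<psi>. Dropping its norm is the only loss in the lemma.\<close>
  have "0 \<le> (s A B z - c *\<^sub>R p B z) \<bullet> (s A B z - c *\<^sub>R p B z)" by simp
  also have "\<dots> = s A B z \<bullet> s A B z - 2 * c * X + c\<^sup>2 * F"
    by (simp add: inner_diff_left inner_diff_right X_def F_def power2_eq_square inner_commute algebra_simps)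
  finally have ABAB: "c\<^sup>2 * F \<le> s A B z \<bullet> s A B z"
    unfolding XF by (simp add: power2_eq_square algebra_simps)
  have cross: "s A A z \<bullet> s B B z \<ge> - (second_deriv h z A A / h z) * F"
  proof -
    have "s A A z \<bullet> s B B z * h z = (s A B z \<bullet> s A B z - c\<^sup>2 * F) * h z - second_deriv h z A A * F"
    proof -
      have hA: "fderiv h z A = c * h z" using hz by (simp add: c_def)
      have "s A A z \<bullet> s B B z = - (U \<bullet> p B z)" using gauss1 by simp
      then show ?thesis
        using gauss2 unfolding hA XF by (simp add: power2_eq_square algebra_simps)
    qed
    moreover have "(s A B z \<bullet> s A B z - c\<^sup>2 * F) * h z \<ge> 0" using ABAB hz by simp
    ultimately have "- second_deriv h z A A * F \<le> s A A z \<bullet> s B B z * h z" by linarith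
    then show ?thesis using hz by (simp add: field_simps)
  qed
  have lin: "linear (\<lambda>u. p u z)"
    unfolding p_def using linear_frechet_derivative[OF Ck_on_2D(1)[OF \<psi>2 z]] .
  have hlin: "linear (fderiv h z)" using linear_frechet_derivative[OF hd(1)[OF z]] .
  \<comment> \<open>The vertical part of \<open>\<Gamma>a\<close> vanishes: \<open>aa_b\<close>
    makes its image under the derivative of \<psi> have length 0, and that derivative is
    injective.\<close>
  have split: "\<Gamma>a = (fst \<Gamma>a, 0) + (0, snd \<Gamma>a)" by simp
  have "p (0, snd \<Gamma>a) z \<bullet> p (0, snd \<Gamma>a) z = 0"
  proof -
    have "p \<Gamma>a z \<bullet> p (0, snd \<Gamma>a) z = 0"
      using \<Gamma>a[of "(0, snd \<Gamma>a)"] aa_b[OF z, of a "snd \<Gamma>a"] by (simp add: p_def s_def inner_diff_left)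
    then show ?thesis using z by (simp add: p_def metric zero)
  qed
  then have "p (0, snd \<Gamma>a) z = p 0 z" using linear_0[OF lin] by simp
  then have vert: "snd \<Gamma>a = 0" using inj by (auto simp: p_def zero_prod_def dest: injD)
  then have \<Gamma>a_eq: "\<Gamma>a = (fst \<Gamma>a, 0)" by (metis prod.collapse)
  \<comment> \<open>As \<open>\<Gamma>a\<close> is horizontal, \<open>HV\<close> with
    \<open>w = B\<close> trades the second derivative along \<open>B\<close> for a mixed one, and
    \<open>ab_b\<close> evaluates that. This yields the gradient term of the Hessian of
    \<open>h\<close>.\<close>
  have "p \<Gamma>a z \<bullet> s B B z = - (s \<Gamma>a B z \<bullet> p B z)"
    using HV[OF z, of "fst \<Gamma>a" B b] s_sym[OF z, of B \<Gamma>a] \<Gamma>a_eq by (simp add: B_def)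
  moreover have "(s \<Gamma>a B z \<bullet> p B z) * h z = fderiv h z \<Gamma>a * F"
    using ab_b[OF z, of "fst \<Gamma>a" b] \<Gamma>a_eq by (simp add: B_def F_def)
  ultimately have "p \<Gamma>a z \<bullet> s B B z * h z = - fderiv h z \<Gamma>a * F" by simp
  then have \<Gamma>BB: "p \<Gamma>a z \<bullet> s B B z = - (fderiv h z \<Gamma>a / h z) * F" using hz by (simp add: field_simps)
  \<comment> \<open>The term with \<open>\<Gamma>b\<close> drops out, since the first factor is
    orthogonal to all tangent vectors.\<close>
  have "(s A A z - p \<Gamma>a z) \<bullet> (s B B z - p \<Gamma>b z) = s A A z \<bullet> s B B z - p \<Gamma>a z \<bullet> s B B z"
    using \<Gamma>a[of \<Gamma>b] by (simp add: inner_diff_right inner_diff_left s_def p_def A_def)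
  also have "\<dots> \<ge> (fderiv h z \<Gamma>a - second_deriv h z A A) / h z * F"
    using cross \<Gamma>BB by (simp add: diff_divide_distrib algebra_simps)
  finally show ?thesis by (simp add: s_def p_def A_def B_def F_def)
qed

section \<open>Products of spheres\<close>

text \<open>Differentiating \<open>\<iota> \<bullet> \<iota> = \<rho>\<close> twice shows that the
  position vector spans the normal line and that the second fundamental form on
  \<open>(v, v)\<close> is the position vector times minus the squared length of \<open>v\<close>
  over \<rho>.\<close>

lemma sphere_normal_curvature:
  fixes \<iota> :: "'e::euclidean_space \<Rightarrow> 'e \<times> real"
  assumes S: "open S" "Ck_on 2 S \<iota>" and sph: "\<And>y. y \<in> S \<Longrightarrow> \<iota> y \<bullet> \<iota> y = \<rho>" "\<rho> > 0"
    and y: "y \<in> S" and inj: "inj (fderiv \<iota> y)"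
    and \<sigma>: "\<And>w. (second_deriv \<iota> y p p - fderiv \<iota> y c) \<bullet> fderiv \<iota> y w = 0"
    and \<tau>: "\<And>w. (second_deriv \<iota> y q q - fderiv \<iota> y d) \<bullet> fderiv \<iota> y w = 0"
  shows "(second_deriv \<iota> y p p - fderiv \<iota> y c) \<bullet> (second_deriv \<iota> y q q - fderiv \<iota> y d)
    = (fderiv \<iota> y p \<bullet> fderiv \<iota> y p) * (fderiv \<iota> y q \<bullet> fderiv \<iota> y q) / \<rho>"
proof -
  note D = Ck_on_2D[OF S(2)]
  note prod_rule = fderiv_bounded_bilinear[OF bounded_bilinear_inner]
  have lin: "linear (fderiv \<iota> y)" by (rule linear_frechet_derivative[OF D(1)[OF y]])
  have orth: "\<iota> x \<bullet> fderiv \<iota> x v = 0" if "x \<in> S" for x v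
  proof -
    have "fderiv (\<lambda>x. \<iota> x \<bullet> \<iota> x) x = fderiv (\<lambda>x. \<rho>) x"
      by (rule fderiv_cong_open[OF S(1) that]) (rule sph)
    then show ?thesis
      using prod_rule(2)[OF D(1)[OF that] D(1)[OF that], of v] by (simp add: inner_commute)
  qed
  have second: "second_deriv \<iota> y v v \<bullet> \<iota> y = - (fderiv \<iota> y v \<bullet> fderiv \<iota> y v)" for v
  proof -
    have "fderiv (\<lambda>x. \<iota> x \<bullet> fderiv \<iota> x v) y = fderiv (\<lambda>x. 0) y"
      by (rule fderiv_cong_open[OF S(1) y]) (rule orth)
    then show ?thesis
      using prod_rule(2)[OF D(1)[OF y] D(2)[OF y], of v v]
      by (simp add: second_deriv_def inner_commute eq_neg_iff_add_eq_0)
  qed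
  have nz: "\<iota> y \<noteq> 0" using sph(1)[OF y] sph(2) by auto
  have normal: "(second_deriv \<iota> y v v - fderiv \<iota> y w)
      = (- (fderiv \<iota> y v \<bullet> fderiv \<iota> y v) / \<rho>) *\<^sub>R \<iota> y"
    if "\<And>u. (second_deriv \<iota> y v v - fderiv \<iota> y w) \<bullet> fderiv \<iota> y u = 0" for v w
  proof -
    have "(second_deriv \<iota> y v v - fderiv \<iota> y w) \<bullet> \<iota> y = - (fderiv \<iota> y v \<bullet> fderiv \<iota> y v)"
      using second[of v] orth[OF y, of w]
      by (simp add: inner_diff_left inner_commute[of "fderiv \<iota> y w"])
    then show ?thesis
      using orthogonal_to_hyperplane_eq[OF lin inj nz orth[OF y] that] sph(1)[OF y] by metis
  qed
  show ?thesis
    unfolding normal[OF \<sigma>] normal[OF \<tau>] using sph(1)[OF y] sph(2) by simp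
qed

lemma fderiv_Pair_fst_snd:
  fixes f :: "'a::real_normed_vector \<Rightarrow> 'c::real_normed_vector"
    and g :: "'b::real_normed_vector \<Rightarrow> 'd::real_normed_vector"
  assumes "f differentiable (at (fst y))" "g differentiable (at (snd y))"
  shows "fderiv (\<lambda>y. (f (fst y), g (snd y))) y v = (fderiv f (fst y) (fst v), fderiv g (snd y) (snd v))"
proof -
  have "((\<lambda>y. (f (fst y), g (snd y))) has_derivative
      (\<lambda>v. (fderiv f (fst y) (fst v), fderiv g (snd y) (snd v)))) (at y)"
    by (intro has_derivative_Pair
        has_derivative_compose[OF has_derivative_fst[OF has_derivative_ident] has_derivative_fderiv[OF assms(1)]]
        has_derivative_compose[OF has_derivative_snd[OF has_derivative_ident] has_derivative_fderiv[OF assms(2)]])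
  from fderiv_eqI[OF this] show ?thesis by simp
qed

lemma second_deriv_Pair_fst_snd:
  assumes f: "open S" "Ck_on 2 S f" "fst y \<in> S" and g: "open T" "Ck_on 2 T g" "snd y \<in> T"
  shows "second_deriv (\<lambda>y. (f (fst y), g (snd y))) y u v
    = (second_deriv f (fst y) (fst u) (fst v), second_deriv g (snd y) (snd u) (snd v))"
proof -
  note df = Ck_on_2D[OF f(2)] and dg = Ck_on_2D[OF g(2)]
  have "second_deriv (\<lambda>y. (f (fst y), g (snd y))) y u v
      = fderiv (\<lambda>y. (fderiv f (fst y) (fst v), fderiv g (snd y) (snd v))) y u"
    unfolding second_deriv_def
    by (rule arg_cong[of _ _ "\<lambda>F. F u"], rule fderiv_cong_open[OF open_Times[OF f(1) g(1)]])
      (use f g in \<open>auto intro!: fderiv_Pair_fst_snd df dg simp: mem_Times_iff\<close>)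
  also have "\<dots> = (second_deriv f (fst y) (fst u) (fst v), second_deriv g (snd y) (snd u) (snd v))"
    unfolding second_deriv_def
    by (rule fderiv_Pair_fst_snd[of "\<lambda>x. fderiv f x (fst v)" _ "\<lambda>x. fderiv g x (snd v)"])
      (intro df(2) dg(2) f(3) g(3))+
  finally show ?thesis .
qed

text \<open>The second fundamental form of the product splits, giving
  \<open>P1 Q1 / \<rho>1 + P2 Q2 / \<rho>2\<close>. Replacing both factors by \<open>K\<close> and
  adding the nonnegative cross terms \<open>P1 Q2\<close> and \<open>P2 Q1\<close> completes the
  product of squared lengths.\<close>

lemma sphere_product_normal_curvature_le:
  fixes \<iota>1 :: "'u::euclidean_space \<Rightarrow> 'u \<times> real" and \<iota>2 :: "'v::euclidean_space \<Rightarrow> 'v \<times> real"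
  defines "\<iota> \<equiv> \<lambda>y. (\<iota>1 (fst y), \<iota>2 (snd y))"
  assumes S1: "open S1" "Ck_on 2 S1 \<iota>1" "\<And>y. y \<in> S1 \<Longrightarrow> \<iota>1 y \<bullet> \<iota>1 y = \<rho>1" "\<rho>1 > 0"
    and S2: "open S2" "Ck_on 2 S2 \<iota>2" "\<And>y. y \<in> S2 \<Longrightarrow> \<iota>2 y \<bullet> \<iota>2 y = \<rho>2" "\<rho>2 > 0"
    and y: "y \<in> S1 \<times> S2" and inj: "inj (fderiv \<iota>1 (fst y))" "inj (fderiv \<iota>2 (snd y))"
    and K: "1 / \<rho>1 \<le> K" "1 / \<rho>2 \<le> K"
    and \<sigma>: "\<And>w. (second_deriv \<iota> y p p - fderiv \<iota> y c) \<bullet> fderiv \<iota> y w = 0"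
    and \<tau>: "\<And>w. (second_deriv \<iota> y q q - fderiv \<iota> y d) \<bullet> fderiv \<iota> y w = 0"
  shows "(second_deriv \<iota> y p p - fderiv \<iota> y c) \<bullet> (second_deriv \<iota> y q q - fderiv \<iota> y d)
    \<le> K * (fderiv \<iota> y p \<bullet> fderiv \<iota> y p) * (fderiv \<iota> y q \<bullet> fderiv \<iota> y q)"
proof -
  have y1: "fst y \<in> S1" and y2: "snd y \<in> S2" using y by auto
  note D1 = Ck_on_2D(1)[OF S1(2) y1] and D2 = Ck_on_2D(1)[OF S2(2) y2]
  have f: "fderiv \<iota> y v = (fderiv \<iota>1 (fst y) (fst v), fderiv \<iota>2 (snd y) (snd v))" for v
    unfolding \<iota>_def by (rule fderiv_Pair_fst_snd[OF D1 D2])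
  have s: "second_deriv \<iota> y u v
      = (second_deriv \<iota>1 (fst y) (fst u) (fst v), second_deriv \<iota>2 (snd y) (snd u) (snd v))" for u v
    unfolding \<iota>_def by (rule second_deriv_Pair_fst_snd[OF S1(1,2) y1 S2(1,2) y2])
  have 0: "fderiv \<iota>1 (fst y) 0 = 0" "fderiv \<iota>2 (snd y) 0 = 0"
    using linear_0[OF linear_frechet_derivative[OF D1]] linear_0[OF linear_frechet_derivative[OF D2]] .
  define P1 where "P1 = fderiv \<iota>1 (fst y) (fst p) \<bullet> fderiv \<iota>1 (fst y) (fst p)"
  define P2 where "P2 = fderiv \<iota>2 (snd y) (snd p) \<bullet> fderiv \<iota>2 (snd y) (snd p)"
  define Q1 where "Q1 = fderiv \<iota>1 (fst y) (fst q) \<bullet> fderiv \<iota>1 (fst y) (fst q)"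
  define Q2 where "Q2 = fderiv \<iota>2 (snd y) (snd q) \<bullet> fderiv \<iota>2 (snd y) (snd q)"
  have nonneg: "0 \<le> P1" "0 \<le> P2" "0 \<le> Q1" "0 \<le> Q2" by (simp_all add: P1_def P2_def Q1_def Q2_def)
  have K0: "0 \<le> K" using K(1) S1(4) by (meson divide_nonneg_pos order_trans zero_le_one)
  \<comment> \<open>Testing the normality assumptions against \<open>(w, 0)\<close>, and below
    against \<open>(0, w)\<close>, isolates the two factors.\<close>
  have "(second_deriv \<iota>1 (fst y) (fst p) (fst p) - fderiv \<iota>1 (fst y) (fst c))
      \<bullet> (second_deriv \<iota>1 (fst y) (fst q) (fst q) - fderiv \<iota>1 (fst y) (fst d)) = P1 * Q1 / \<rho>1"
    unfolding P1_def Q1_def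
    by (rule sphere_normal_curvature[OF S1 y1 inj(1)])
      (use \<sigma>[of "(w, 0)" for w] \<tau>[of "(w, 0)" for w] in \<open>simp_all add: f s 0\<close>)
  moreover have "(second_deriv \<iota>2 (snd y) (snd p) (snd p) - fderiv \<iota>2 (snd y) (snd c))
      \<bullet> (second_deriv \<iota>2 (snd y) (snd q) (snd q) - fderiv \<iota>2 (snd y) (snd d)) = P2 * Q2 / \<rho>2"
    unfolding P2_def Q2_def
    by (rule sphere_normal_curvature[OF S2 y2 inj(2)])
      (use \<sigma>[of "(0, w)" for w] \<tau>[of "(0, w)" for w] in \<open>simp_all add: f s 0\<close>)
  ultimately have "(second_deriv \<iota> y p p - fderiv \<iota> y c) \<bullet> (second_deriv \<iota> y q q - fderiv \<iota> y d)
      = (1 / \<rho>1) * (P1 * Q1) + (1 / \<rho>2) * (P2 * Q2)"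
    by (simp add: f s)
  also have "\<dots> \<le> K * (P1 * Q1) + K * (P2 * Q2)"
    using K nonneg by (intro add_mono mult_right_mono) auto
  also have "\<dots> \<le> K * ((P1 + P2) * (Q1 + Q2))"
    using K0 nonneg by (simp add: algebra_simps)
  also have "\<dots> = K * (fderiv \<iota> y p \<bullet> fderiv \<iota> y p) * (fderiv \<iota> y q \<bullet> fderiv \<iota> y q)"
    by (simp add: f P1_def P2_def Q1_def Q2_def mult.assoc)
  finally show ?thesis .
qed

section \<open>The inequality in coordinates\<close>

text \<open>The situation read in fixed charts: \<open>h\<close> is the warping function, \<phi> the
  immersion, and \<iota> a parametrisation of the target inducing \<open>gN\<close>. The metric
  identities hold on open sets because they are differentiated; injectivity and the curvature bound
  \<open>K\<close> are stated at one point.\<close>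

locale warped_product_immersion =
  fixes \<Omega> :: "('a::euclidean_space \<times> 'b::euclidean_space) set" and z :: "'a \<times> 'b"
    and h :: "'a \<times> 'b \<Rightarrow> real"
    and gB :: "'a \<Rightarrow> 'a \<Rightarrow> 'a \<Rightarrow> real" and gF :: "'b \<Rightarrow> 'b \<Rightarrow> 'b \<Rightarrow> real"
    and gM :: "'a \<times> 'b \<Rightarrow> 'a \<times> 'b \<Rightarrow> 'a \<times> 'b \<Rightarrow> real"
    and \<phi> :: "'a \<times> 'b \<Rightarrow> 'd::euclidean_space"
    and S :: "'d set" and \<iota> :: "'d \<Rightarrow> 'w::euclidean_space" and gN :: "'d \<Rightarrow> 'd \<Rightarrow> 'd \<Rightarrow> real"
    and K :: real
  assumes \<Omega>: "open \<Omega>" and z: "z \<in> \<Omega>"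
    and h: "Ck_on 2 \<Omega> h" "\<And>y. y \<in> \<Omega> \<Longrightarrow> h y > 0"
    and gM: "\<And>y u v. y \<in> \<Omega> \<Longrightarrow>
      gM y u v = gB (fst y) (fst u) (fst v) + (h y)\<^sup>2 * gF (snd y) (snd u) (snd v)"
    and zero: "\<And>y u. y \<in> \<Omega> \<Longrightarrow> gB (fst y) u 0 = 0" "\<And>y u. y \<in> \<Omega> \<Longrightarrow> gB (fst y) 0 u = 0"
      "\<And>y u. y \<in> \<Omega> \<Longrightarrow> gF (snd y) u 0 = 0" "\<And>y u. y \<in> \<Omega> \<Longrightarrow> gF (snd y) 0 u = 0"
    and \<phi>: "Ck_on 3 \<Omega> \<phi>" "\<phi> ` \<Omega> \<subseteq> S" "inj (fderiv \<phi> z)"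
    and iso: "\<And>y u v. y \<in> \<Omega> \<Longrightarrow> gM y u v = gN (\<phi> y) (fderiv \<phi> y u) (fderiv \<phi> y v)"
    and S: "open S" and \<iota>: "Ck_on 3 S \<iota>" "inj (fderiv \<iota> (\<phi> z))"
    and gN: "\<And>y u v. y \<in> S \<Longrightarrow> gN y u v = fderiv \<iota> y u \<bullet> fderiv \<iota> y v"
    and normal_curvature: "\<And>p q c d.
      (\<And>w. (second_deriv \<iota> (\<phi> z) p p - fderiv \<iota> (\<phi> z) c) \<bullet> fderiv \<iota> (\<phi> z) w = 0) \<Longrightarrow>
      (\<And>w. (second_deriv \<iota> (\<phi> z) q q - fderiv \<iota> (\<phi> z) d) \<bullet> fderiv \<iota> (\<phi> z) w = 0) \<Longrightarrow>
      (second_deriv \<iota> (\<phi> z) p p - fderiv \<iota> (\<phi> z) c) \<bullet> (second_deriv \<iota> (\<phi> z) q q - fderiv \<iota> (\<phi> z) d)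
      \<le> K * (fderiv \<iota> (\<phi> z) p \<bullet> fderiv \<iota> (\<phi> z) p) * (fderiv \<iota> (\<phi> z) q \<bullet> fderiv \<iota> (\<phi> z) q)"
begin

text \<open>The value of \<open>second_fundamental_form\<close> on vectors at \<open>z\<close>
  instead of fields, with no derivative of the fields left; see
  \<open>second_fundamental_form_eq_II\<close>.\<close>

definition II :: "'a \<times> 'b \<Rightarrow> 'a \<times> 'b \<Rightarrow> 'd" where
  "II u v = second_deriv \<phi> z u v + christoffel gN (\<phi> z) (fderiv \<phi> z u) (fderiv \<phi> z v)
     - fderiv \<phi> z (christoffel gM z u v)"

abbreviation \<psi> :: "'a \<times> 'b \<Rightarrow> 'w" where "\<psi> y \<equiv> \<iota> (\<phi> y)"

abbreviation D\<iota> :: "'d \<Rightarrow> 'w" where "D\<iota> \<equiv> fderiv \<iota> (\<phi> z)"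

lemma C2: "Ck_on 2 \<Omega> \<phi>" "Ck_on 2 S \<iota>" "Ck_on 2 \<Omega> \<psi>" and \<psi>_C3: "Ck_on 3 \<Omega> \<psi>"
proof -
  show C3: "Ck_on 3 \<Omega> \<psi>" by (rule Ck_on_compose[OF \<Omega> \<phi>(2,1) \<iota>(1)])
  show "Ck_on 2 \<Omega> \<phi>" "Ck_on 2 S \<iota>" "Ck_on 2 \<Omega> \<psi>"
    by (rule Ck_on_mono[OF \<phi>(1)] Ck_on_mono[OF \<iota>(1)] Ck_on_mono[OF C3]; simp)+
qed

lemma \<phi>z: "\<phi> z \<in> S" using \<phi>(2) z by blast

lemma fderiv_\<psi>: "y \<in> \<Omega> \<Longrightarrow> fderiv \<psi> y u = fderiv \<iota> (\<phi> y) (fderiv \<phi> y u)"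
  by (rule fderiv_compose(2)) (use C2 \<phi>(2) in \<open>auto intro: Ck_on_2D(1)\<close>)

text \<open>Because \<phi> is isometric and \<iota> induces \<open>gN\<close>, the composite induces
  \<open>gM\<close>. So \<open>christoffel_induced\<close> applies to both metrics.\<close>

lemma gM_\<psi>: "y \<in> \<Omega> \<Longrightarrow> gM y u v = fderiv \<psi> y u \<bullet> fderiv \<psi> y v"
  using \<phi>(2) by (auto simp: iso gN fderiv_\<psi>)

lemma linear_fderivs: "linear (fderiv \<phi> z)" "linear D\<iota>" "linear (fderiv \<psi> z)"
  using linear_frechet_derivative Ck_on_2D(1) C2 z \<phi>z by blast+

lemma inj_fderiv_\<psi>: "inj (fderiv \<psi> z)"
proof -
  have "fderiv \<psi> z = D\<iota> \<circ> fderiv \<phi> z" using fderiv_\<psi>[OF z] by auto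
  then show ?thesis using inj_compose[OF \<iota>(2) \<phi>(3)] by simp
qed

lemma christoffel_gM:
  "bilinear (christoffel gM z)"
  "(second_deriv \<psi> z u v - fderiv \<psi> z (christoffel gM z u v)) \<bullet> fderiv \<psi> z w = 0"
  using christoffel_induced[OF \<Omega> C2(3) z inj_fderiv_\<psi>, of gM] gM_\<psi> by blast+

lemma christoffel_gN:
  "bilinear (christoffel gN (\<phi> z))"
  "(second_deriv \<iota> (\<phi> z) p q - D\<iota> (christoffel gN (\<phi> z) p q)) \<bullet> D\<iota> w = 0"
  using christoffel_induced[OF S C2(2) \<phi>z \<iota>(2), of gN] gN by blast+

text \<open>Traces are formed after applying \<open>D\<iota>\<close>, under which
  \<open>gN (\<phi> z)\<close> becomes the Euclidean inner product.\<close>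

lemma bilinear_D\<iota>_II: "bilinear (\<lambda>u v. D\<iota> (II u v))"
proof -
  note l = linear_fderivs and s = linear_second_deriv[OF \<Omega> C2(1) z]
  note rules = linear_add[OF l(1)] linear_add[OF l(2)] linear_cmul[OF l(1)] linear_cmul[OF l(2)]
    linear_add[OF s(1)] linear_add[OF s(2)] linear_cmul[OF s(1)] linear_cmul[OF s(2)]
    bilinear_ladd[OF christoffel_gM(1)] bilinear_radd[OF christoffel_gM(1)]
    bilinear_lmul[OF christoffel_gM(1)] bilinear_rmul[OF christoffel_gM(1)]
    bilinear_ladd[OF christoffel_gN(1)] bilinear_radd[OF christoffel_gN(1)]
    bilinear_lmul[OF christoffel_gN(1)] bilinear_rmul[OF christoffel_gN(1)] linear_diff[OF l(2)]
  show ?thesis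
    unfolding bilinear_def II_def
    by (intro conjI allI linearI) (simp_all add: rules algebra_simps)
qed

text \<open>The second fundamental form of \<open>\<psi>\<close> is the orthogonal sum of those of \<open>\<phi>\<close> and \<open>\<iota>\<close>.\<close>

lemma gauss_inequality:
  "(fderiv h z (christoffel gM z (a, 0) (a, 0)) - second_deriv h z (a, 0) (a, 0)) / h z
      * gM z (0, b) (0, b)
    \<le> D\<iota> (II (a, 0) (a, 0)) \<bullet> D\<iota> (II (0, b) (0, b)) + K * gM z (a, 0) (a, 0) * gM z (0, b) (0, b)"
proof -
  define A where "A = (a, 0::'b)"
  define B where "B = (0::'a, b)"
  define \<sigma> where "\<sigma> p = second_deriv \<iota> (\<phi> z) p p - D\<iota> (christoffel gN (\<phi> z) p p)" for p
  have decomp: "second_deriv \<psi> z u u - fderiv \<psi> z (christoffel gM z u u)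
      = D\<iota> (II u u) + \<sigma> (fderiv \<phi> z u)" for u
    unfolding second_deriv_compose[OF S C2(2) \<Omega> C2(1) \<phi>(2) z] fderiv_\<psi>[OF z] II_def \<sigma>_def
    by (simp add: linear_add[OF linear_fderivs(2)] linear_diff[OF linear_fderivs(2)])
  \<comment> \<open>\<sigma> is normal to the target and \<open>D\<iota>\<close> takes tangential
    values, so the mixed terms of the product below vanish.\<close>
  have orth: "\<sigma> p \<bullet> D\<iota> w = 0" for p w unfolding \<sigma>_def by (rule christoffel_gN(2))
  have "(fderiv h z (christoffel gM z A A) - second_deriv h z A A) / h z
      * (fderiv \<psi> z B \<bullet> fderiv \<psi> z B)
    \<le> (second_deriv \<psi> z A A - fderiv \<psi> z (christoffel gM z A A))
      \<bullet> (second_deriv \<psi> z B B - fderiv \<psi> z (christoffel gM z B B))"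
    unfolding A_def B_def
    by (rule warped_immersion_gauss_inequality[OF \<Omega> \<psi>_C3 h, of gB gF])
      (simp_all add: gM_\<psi>[symmetric] gM zero z inj_fderiv_\<psi> christoffel_gM(2))
  also have "\<dots> = D\<iota> (II A A) \<bullet> D\<iota> (II B B) + \<sigma> (fderiv \<phi> z A) \<bullet> \<sigma> (fderiv \<phi> z B)"
    unfolding decomp
    by (simp add: inner_add_left inner_add_right orth inner_commute[of "D\<iota> _" "\<sigma> _"])
  also have "\<sigma> (fderiv \<phi> z A) \<bullet> \<sigma> (fderiv \<phi> z B) \<le> K * gM z A A * gM z B B"
    unfolding \<sigma>_def gM_\<psi>[OF z] fderiv_\<psi>[OF z]
    by (rule normal_curvature) (rule christoffel_gN(2))+
  finally show ?thesis unfolding A_def B_def gM_\<psi>[OF z] by simp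
qed

text \<open>The derivative of \<open>Y\<close> enters once through the field along \<phi> and once
  through the connection of the source, and cancels.\<close>

lemma second_fundamental_form_eq_II:
  assumes "Y differentiable (at z)"
  shows "levi_civita_along gN \<phi> X (dir_deriv Y \<phi>) z - dir_deriv (levi_civita gM X Y) \<phi> z
    = II (X z) (Y z)"
proof -
  have "dir_deriv X (dir_deriv Y \<phi>) z
      = second_deriv \<phi> z (X z) (Y z) + fderiv \<phi> z (fderiv Y z (X z))"
    using fderiv_of_fderiv_along[OF \<Omega> C2(1), of "\<lambda>w. w" z Y "X z"] z assms
    by (simp add: dir_deriv_def[abs_def])
  then show ?thesis
    by (simp add: levi_civita_along_def levi_civita_def II_def linear_add[OF linear_fderivs(1)]
        dir_deriv_def)
qed

text \<open>The same cancellation for the derivative of \<open>X\<close> leaves minus the Hessian of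
  \<open>h\<close>, evaluated on \<open>X z\<close>.\<close>

lemma hessian_term_eq:
  assumes "X differentiable (at z)"
  shows "dir_deriv (levi_civita gM X X) h z - dir_deriv X (dir_deriv X h) z
    = fderiv h z (christoffel gM z (X z) (X z)) - second_deriv h z (X z) (X z)"
proof -
  have "dir_deriv X (dir_deriv X h) z
      = second_deriv h z (X z) (X z) + fderiv h z (fderiv X z (X z))"
    using fderiv_of_fderiv_along[OF \<Omega> h(1), of "\<lambda>w. w" z X "X z"] z assms
    by (simp add: dir_deriv_def[abs_def])
  then show ?thesis
    using linear_add[OF linear_frechet_derivative[OF Ck_on_2D(1)[OF h(1) z]]]
    by (simp add: levi_civita_def dir_deriv_def)
qed

text \<open>Sum \<open>gauss_inequality\<close> over all pairs of a horizontal \<open>e k\<close>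
  and a vertical \<open>c\<close>. The left side does not depend on \<open>c\<close>, whence the
  factor \<open>DIM('b)\<close>; the products of second fundamental forms add up to the product of
  the two partial traces.\<close>

lemma sum_gauss_inequality:
  fixes e :: "nat \<Rightarrow> 'a" and \<epsilon> :: "nat \<Rightarrow> 'a \<times> 'b"
  assumes e: "\<And>k l. k \<in> {1..DIM('a)} \<Longrightarrow> l \<in> {1..DIM('a)} \<Longrightarrow>
      gM z (e k, 0) (e l, 0) = (if k = l then 1 else 0)"
    and \<epsilon>: "\<And>k l. k \<in> {1..DIM('a \<times> 'b)} \<Longrightarrow> l \<in> {1..DIM('a \<times> 'b)} \<Longrightarrow>
      gM z (\<epsilon> k) (\<epsilon> l) = (if k = l then 1 else 0)"
  defines "H \<equiv> \<Sum>k = 1..DIM('a \<times> 'b). II (\<epsilon> k) (\<epsilon> k)"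
  shows "DIM('b) * (\<Sum>k = 1..DIM('a).
        (fderiv h z (christoffel gM z (e k, 0) (e k, 0)) - second_deriv h z (e k, 0) (e k, 0)) / h z)
    \<le> gN (\<phi> z) H H / 4 + DIM('a) * DIM('b) * K"
proof -
  have gMz: "gM z = (\<lambda>u v. fderiv \<psi> z u \<bullet> fderiv \<psi> z v)" using gM_\<psi>[OF z] by (simp add: fun_eq_iff)
  have inner: "inner_product (gM z)"
    unfolding gMz by (rule inner_product_induced[OF linear_fderivs(3) inj_fderiv_\<psi>])
  have lin: "linear (\<lambda>b. fderiv \<psi> z (0, b))"
    by (rule linear_compose[of "\<lambda>b. (0, b)", OF _ linear_fderivs(3), unfolded o_def])
      (auto intro!: linearI)
  have "inj (\<lambda>b. fderiv \<psi> z (0, b))"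
    using inj_fderiv_\<psi> by (auto simp: inj_def)
  \<comment> \<open>A vertical basis, orthonormal for \<open>gM z\<close> and so already scaled by
    the warping function, to complement the given horizontal vectors.\<close>
  then obtain C where C: "finite C" "card C = DIM('b)" "\<And>c d. c \<in> C \<Longrightarrow> d \<in> C \<Longrightarrow>
      fderiv \<psi> z (0, c) \<bullet> fderiv \<psi> z (0, d) = (if c = d then 1 else 0)"
    using orthonormal_preimage_exists[OF lin] by metis
  define I where "I = {1..DIM('a)} <+> C"
  define w where "w = case_sum (\<lambda>k. (e k, 0::'b)) (\<lambda>c. (0::'a, c))"
  have I: "finite I" "card I = DIM('a \<times> 'b)" using C(1,2) by (simp_all add: I_def card_Plus)
  have w: "gM z (w i) (w j) = (if i = j then 1 else 0)" if "i \<in> I" "j \<in> I" for i j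
    using that e C(3) by (auto simp: I_def w_def gM_\<psi>[OF z, of "(0, _)" "(0, _)"] gM[OF z, of "(_, 0)" "(0, _)"]
        gM[OF z, of "(0, _)" "(_, 0)"] zero z split: if_splits)
  define Q where "Q u = D\<iota> (II u u)" for u
  define V1 where "V1 = (\<Sum>k = 1..DIM('a). Q (e k, 0))"
  define V2 where "V2 = (\<Sum>c\<in>C. Q (0, c))"
  have "V1 + V2 = (\<Sum>i\<in>I. Q (w i))"
    unfolding I_def w_def V1_def V2_def by (simp add: sum.Plus C(1))
  \<comment> \<open>The frame \<epsilon> is not assumed to split into horizontal and vertical
    vectors; the trace is the same for it and for \<open>w\<close>.\<close>
  also have "\<dots> = (\<Sum>k = 1..DIM('a \<times> 'b). Q (\<epsilon> k))"
    unfolding Q_def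
    by (rule trace_orthonormal_family_eq[OF inner bilinear_D\<iota>_II I w])
      (use \<epsilon> in auto)
  also have "\<dots> = D\<iota> H" by (simp add: H_def Q_def linear_sum[OF linear_fderivs(2)])
  finally have V: "V1 + V2 = D\<iota> H" .
  define \<delta> where "\<delta> k = (fderiv h z (christoffel gM z (e k, 0) (e k, 0))
      - second_deriv h z (e k, 0) (e k, 0)) / h z" for k
  have "DIM('b) * (\<Sum>k = 1..DIM('a). \<delta> k) = (\<Sum>k = 1..DIM('a). \<Sum>c\<in>C. \<delta> k)"
    by (simp add: C(2) sum_distrib_left)
  also have "\<dots> \<le> (\<Sum>k = 1..DIM('a). \<Sum>c\<in>C. Q (e k, 0) \<bullet> Q (0, c) + K)"
  proof (intro sum_mono)
    fix k c assume "k \<in> {1..DIM('a)}" "c \<in> C"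
    then have "gM z (e k, 0) (e k, 0) = 1" "gM z (0, c) (0, c) = 1"
      using e[of k k] C(3)[of c c] by (simp_all add: gM_\<psi>[OF z, of "(0, _)"])
    then show "\<delta> k \<le> Q (e k, 0) \<bullet> Q (0, c) + K"
      using gauss_inequality[of "e k" c] by (simp add: \<delta>_def Q_def)
  qed
  also have "\<dots> = V1 \<bullet> V2 + DIM('a) * DIM('b) * K"
    by (simp add: sum.distrib C(2) V1_def V2_def inner_sum_left inner_sum_right) (rule sum.swap)
  \<comment> \<open>The difference of the two sides is a quarter of the squared norm of
    \<open>V1 - V2\<close>.\<close>
  also have "V1 \<bullet> V2 \<le> (V1 + V2) \<bullet> (V1 + V2) / 4"
  proof -
    have "0 \<le> (V1 - V2) \<bullet> (V1 - V2)" by simp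
    then show ?thesis by (simp add: inner_add_left inner_add_right inner_diff_left inner_diff_right inner_commute)
  qed
  also have "(V1 + V2) \<bullet> (V1 + V2) = gN (\<phi> z) H H" unfolding V by (simp add: gN \<phi>z)
  finally show ?thesis by (simp add: \<delta>_def)
qed

end

section \<open>Charts\<close>

lemma chart_inj_on:
  assumes "smooth_manifold M" "i \<in> chart_index M"
  shows "inj_on (chart_map M i) (chart_dom M i)"
proof -
  have "openin (mtop M) (chart_dom M i)"
    "homeomorphic_map (subtopology (mtop M) (chart_dom M i)) (top_of_set (chart_range M i)) (chart_map M i)"
    using assms by (auto simp: smooth_manifold_def)
  then show ?thesis
    using homeomorphic_imp_injective_map openin_subset
    by (metis topspace_subtopology_subset)
qed

lemma chart_image_open:
  assumes "smooth_manifold M" "i \<in> chart_index M" "openin (mtop M) U" "U \<subseteq> chart_dom M i"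
  shows "open (chart_map M i ` U)"
proof -
  have M: "open (chart_range M i)"
    "homeomorphic_map (subtopology (mtop M) (chart_dom M i)) (top_of_set (chart_range M i)) (chart_map M i)"
    using assms by (auto simp: smooth_manifold_def)
  have "openin (subtopology (mtop M) (chart_dom M i)) U"
    using assms(3,4) by (metis openin_subtopology inf.absorb1)
  then have "openin (top_of_set (chart_range M i)) (chart_map M i ` U)"
    using homeomorphic_imp_open_map[OF M(2)] by (simp add: open_map_def)
  then show ?thesis using M(1) openin_open_trans by blast
qed

lemma inv_into_chart_product:
  assumes "inj_on c A" "inj_on d B" "x \<in> A" "y \<in> B"
  shows "inv_into (A \<times> B) (\<lambda>(x, y). (c x, d y)) (c x, d y) = (x, y)"
proof -
  have "inj_on (\<lambda>(x, y). (c x, d y)) (A \<times> B)" using assms by (auto simp: inj_on_def)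
  from inv_into_f_f[OF this, of "(x, y)"] show ?thesis using assms by simp
qed

lemma chart_inv_warped_product:
  assumes "inj_on (chart_map B i) (chart_dom B i)" "inj_on (chart_map F j) (chart_dom F j)"
    and "x \<in> chart_dom B i" "y \<in> chart_dom F j"
  shows "chart_inv (warped_product B f F) (i, j) (chart_map B i x, chart_map F j y) = (x, y)"
  using inv_into_chart_product[OF assms] by (simp add: chart_inv_def warped_product_def)

lemma local_metric_warped_product:
  assumes "inj_on (chart_map B i) (chart_dom B i)" "inj_on (chart_map F j) (chart_dom F j)"
    and "x \<in> chart_dom B i" "y \<in> chart_dom F j"
  shows "local_metric (warped_product B f F) (i, j) (chart_map B i x, chart_map F j y) u v
    = local_metric B i (chart_map B i x) (fst u) (fst v)
      + (f x)\<^sup>2 * local_metric F j (chart_map F j y) (snd u) (snd v)"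
  using chart_inv_warped_product[OF assms, of f] assms
  by (simp add: local_metric_def) (simp add: warped_product_def chart_inv_def)

text \<open>Unpacks the atlas of \<open>euclidean_submanifold\<close>: the inverse of a chart is a
  local parametrisation of the sphere, and it plays the role of \<iota> for each factor of the
  torus.\<close>

lemma round_sphere_chart:
  fixes \<kappa> :: "'u::euclidean_space sphere_chart"
  assumes "\<kappa> \<in> chart_index (round_sphere r)"
  defines "\<iota> \<equiv> chart_inv (round_sphere r) \<kappa>"
  shows "inj_on (chart_map (round_sphere r) \<kappa>) (chart_dom (round_sphere r) \<kappa>)"
    and "openin (mtop (round_sphere r :: (_, 'u sphere_chart, 'u) riem)) (chart_dom (round_sphere r) \<kappa>)"
    and "open (chart_range (round_sphere r) \<kappa>)"
    and "Ck_on n (chart_range (round_sphere r) \<kappa>) \<iota>"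
    and "y \<in> chart_range (round_sphere r) \<kappa> \<Longrightarrow> inj (fderiv \<iota> y)"
    and "y \<in> chart_range (round_sphere r) \<kappa> \<Longrightarrow> \<iota> y \<bullet> \<iota> y = r\<^sup>2"
    and "y \<in> chart_range (round_sphere r) \<kappa> \<Longrightarrow>
      local_metric (round_sphere r) \<kappa> y u v = fderiv \<iota> y u \<bullet> fderiv \<iota> y v"
proof -
  obtain U c where \<kappa>: "\<kappa> = (U, c)" by fastforce
  have dom: "chart_dom (round_sphere r) \<kappa> = U" "chart_map (round_sphere r) \<kappa> = c"
    "chart_range (round_sphere r) \<kappa> = c ` U" "mtop (round_sphere r) = top_of_set (sphere 0 r)"
    "\<iota> = inv_into U c"
    by (simp_all add: \<kappa> round_sphere_def euclidean_submanifold_def chart_range_def chart_inv_def \<iota>_def)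
  have U: "openin (top_of_set (sphere 0 r)) U" "open (c ` U)"
    "homeomorphic_map (top_of_set U) (top_of_set (c ` U)) c"
    "smooth_on (c ` U) (inv_into U c)" "\<forall>y\<in>c ` U. inj (fderiv (inv_into U c) y)"
    using assms(1) by (auto simp: \<kappa> round_sphere_def euclidean_submanifold_def)
  have inj: "inj_on c U" using homeomorphic_imp_injective_map[OF U(3)] by simp
  show "inj_on (chart_map (round_sphere r) \<kappa>) (chart_dom (round_sphere r) \<kappa>)" using inj by (simp add: dom)
  show "openin (mtop (round_sphere r :: (_, 'u sphere_chart, 'u) riem)) (chart_dom (round_sphere r) \<kappa>)"
    using U(1) by (simp add: dom)
  show "open (chart_range (round_sphere r) \<kappa>)" using U(2) by (simp add: dom)
  show "Ck_on n (chart_range (round_sphere r) \<kappa>) \<iota>" using U(4) by (simp add: dom smooth_on_def)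
  assume y: "y \<in> chart_range (round_sphere r) \<kappa>"
  show "inj (fderiv \<iota> y)" using U(5) y by (auto simp: dom)
  have yU: "inv_into U c y \<in> U" "c (inv_into U c y) = y"
    using y by (auto simp: dom inv_into_into f_inv_into_f)
  then have "\<iota> y \<in> sphere 0 r" using openin_imp_subset[OF U(1)] by (auto simp: dom)
  then show "\<iota> y \<bullet> \<iota> y = r\<^sup>2" by (simp add: dot_square_norm)
  show "local_metric (round_sphere r) \<kappa> y u v = fderiv \<iota> y u \<bullet> fderiv \<iota> y v"
    using yU by (simp add: local_metric_def \<iota>_def)
      (simp add: \<kappa> chart_inv_def round_sphere_def euclidean_submanifold_def Let_def)
qed

lemma horizontal_lift_differentiable:
  assumes "X differentiable (at (fst z))"
  shows "(horizontal_lift X :: 'a::real_normed_vector \<times> 'b::real_normed_vector \<Rightarrow> 'a \<times> 'b)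
    differentiable (at z)"
proof -
  have "((\<lambda>w. (X (fst w), 0 :: 'b)) has_derivative (\<lambda>v. (fderiv X (fst z) (fst v), 0))) (at z)"
    by (intro has_derivative_Pair has_derivative_const
        has_derivative_compose[OF has_derivative_fst[OF has_derivative_ident] has_derivative_fderiv[OF assms]])
  then show ?thesis unfolding differentiable_def horizontal_lift_def[abs_def] by blast
qed

lemma local_orthonormal_frameD:
  fixes M :: "('p, 'i, 'e::euclidean_space) riem"
  assumes "local_orthonormal_frame M i p e" "k \<in> {1..DIM('e)}" "l \<in> {1..DIM('e)}"
  shows "e k differentiable (at (chart_map M i p))"
    and "local_metric M i (chart_map M i p) (e k (chart_map M i p)) (e l (chart_map M i p))
      = (if k = l then 1 else 0)"
proof -
  obtain V where V: "chart_map M i p \<in> V" "smooth_on V (e k)"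
    "\<And>y. y \<in> V \<Longrightarrow> local_metric M i y (e k y) (e l y) = (if k = l then 1 else 0)"
    using assms unfolding local_orthonormal_frame_def by blast
  show "local_metric M i (chart_map M i p) (e k (chart_map M i p)) (e l (chart_map M i p))
      = (if k = l then 1 else 0)"
    by (rule V(3)[OF V(1)])
  have "Ck_on 2 V (e k)" using V(2) by (simp add: smooth_on_def)
  then show "e k differentiable (at (chart_map M i p))" using V(1) by (rule Ck_on_2D(1))
qed

lemma local_metric_zero:
  assumes "riemannian_manifold M" "chart_at M i q"
  shows "local_metric M i (chart_map M i q) u 0 = 0" "local_metric M i (chart_map M i q) 0 u = 0"
proof -
  have M: "smooth_manifold M" and "inner_product (rmetric M i q)"
    using assms unfolding riemannian_manifold_def by blast+
  then have "bilinear (rmetric M i q)" by (simp add: inner_product_def)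
  moreover have "chart_inv M i (chart_map M i q) = q"
    using chart_inj_on[OF M, of i] assms(2) by (simp add: chart_at_def chart_inv_def)
  ultimately show "local_metric M i (chart_map M i q) u 0 = 0" "local_metric M i (chart_map M i q) 0 u = 0"
    by (simp_all add: local_metric_def bilinear_lzero bilinear_rzero)
qed

theorem corollary4p5:
  fixes B :: "('b, 'i, 'e1::euclidean_space) riem"
    and F :: "('c, 'j, 'e2::euclidean_space) riem"
    and f :: "'b \<Rightarrow> real"
    and \<phi> :: "'b \<times> 'c \<Rightarrow> ('u::euclidean_space \<times> real) \<times> ('v::euclidean_space \<times> real)"
    and n n1 n2 m m1 m2 :: nat
  assumes "riemannian_manifold B" and "n1 = DIM('e1)"
    and "riemannian_manifold F" and "n2 = DIM('e2)"
    and "n = n1 + n2"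
    and "smooth_function B f" and "\<forall>x\<in>topspace (mtop B). f x > 0"
    and "m1 = DIM('u)" and "m2 = DIM('v)" and "m = m1 + m2"
    and "2 \<le> m1" and "real m1 \<le> real m / 2" and "m \<ge> 4"
    and "isometric_immersion (warped_product B f F) clifford_torus \<phi>"
    and "p \<in> topspace (mtop (warped_product B f F))"
    and "local_orthonormal_frame B i (fst p) e"
    and "chart_at F j (snd p)"
    and "local_orthonormal_frame (warped_product B f F) (i, j) p \<epsilon>"
    and "chart_at clifford_torus k (\<phi> p)"
  shows "laplacian B i F j e f p / f (fst p)
    \<le> (real n)\<^sup>2 / (4 * real n2) *
        squared_mean_curvature (warped_product B f F) (i, j) clifford_torus k \<phi> \<epsilon> p
      + real n1 * real m / real m1"
proof -

  \<comment> \<open>The chart of the warped product at the point\<close>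
  define M where "M = warped_product B f F"
  define N where "N = (clifford_torus :: (('u \<times> real) \<times> ('v \<times> real), 'u sphere_chart \<times> 'v sphere_chart, 'u \<times> 'v) riem)"
  have mB: "smooth_manifold B" and mF: "smooth_manifold F"
    using assms(1,3) by (simp_all add: riemannian_manifold_def)
  have ci: "chart_at B i (fst p)" using assms(16) by (simp add: local_orthonormal_frame_def)
  have i: "i \<in> chart_index B" "fst p \<in> chart_dom B i" and j: "j \<in> chart_index F" "snd p \<in> chart_dom F j"
    using ci assms(17) by (simp_all add: chart_at_def)
  note injB = chart_inj_on[OF mB i(1)] and injF = chart_inj_on[OF mF j(1)]
  have openB: "openin (mtop B) (chart_dom B i)" and openF: "openin (mtop F) (chart_dom F j)"
    using mB mF i j by (simp_all add: smooth_manifold_def)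
  have M_simps: "mtop M = prod_topology (mtop B) (mtop F)" "(i, j) \<in> chart_index M"
    "chart_dom M (i, j) = chart_dom B i \<times> chart_dom F j"
    "chart_map M (i, j) (x, y) = (chart_map B i x, chart_map F j y)" for x y
    using i j by (simp_all add: M_def warped_product_def)
  define z where "z = chart_map M (i, j) p"
  have z_eq: "z = (chart_map B i (fst p), chart_map F j (snd p))"
    using M_simps(4)[of "fst p" "snd p"] by (simp add: z_def)

  \<comment> \<open>Parametrisation of the torus by two spheres\<close>
  define r1 where "r1 = sqrt (real DIM('u) / real (DIM('u) + DIM('v)))"
  define r2 where "r2 = sqrt (real DIM('v) / real (DIM('u) + DIM('v)))"
  obtain k1 k2 where k: "k = (k1, k2)" by (cases k)
  define R1 where "R1 = (round_sphere r1 :: ('u \<times> real, 'u sphere_chart, 'u) riem)"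
  define R2 where "R2 = (round_sphere r2 :: ('v \<times> real, 'v sphere_chart, 'v) riem)"
  have N_eq: "N = warped_product R1 (\<lambda>_. 1) R2"
    by (simp add: N_def clifford_torus_def riemannian_product_def R1_def R2_def r1_def r2_def)
  have kN: "chart_at N k (\<phi> p)" using assms(19) by (simp add: N_def)
  then have k12: "k1 \<in> chart_index R1" "k2 \<in> chart_index R2"
    by (simp_all add: chart_at_def N_eq warped_product_def k)
  have N_simps: "mtop N = prod_topology (mtop R1) (mtop R2)"
    "chart_dom N k = chart_dom R1 k1 \<times> chart_dom R2 k2"
    "chart_map N k (x, y) = (chart_map R1 k1 x, chart_map R2 k2 y)" for x y
    by (simp_all add: N_eq warped_product_def k)
  note sph1 = round_sphere_chart[OF k12(1)[unfolded R1_def], folded R1_def]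
    and sph2 = round_sphere_chart[OF k12(2)[unfolded R2_def], folded R2_def]
  define \<iota>1 where "\<iota>1 = chart_inv R1 k1"
  define \<iota>2 where "\<iota>2 = chart_inv R2 k2"
  define S1 where "S1 = chart_range R1 k1"
  define S2 where "S2 = chart_range R2 k2"
  define \<iota> where "\<iota> = (\<lambda>y. (\<iota>1 (fst y), \<iota>2 (snd y)))"
  note sph1 = sph1[folded \<iota>1_def S1_def] and sph2 = sph2[folded \<iota>2_def S2_def]
  have openS: "open (S1 \<times> S2)" using sph1(3) sph2(3) by (rule open_Times)
  have f\<iota>: "fderiv \<iota> y v = (fderiv \<iota>1 (fst y) (fst v), fderiv \<iota>2 (snd y) (snd v))"
    if "y \<in> S1 \<times> S2" for y v
    unfolding \<iota>_def
    using that by (intro fderiv_Pair_fst_snd Ck_on_2D(1)[OF sph1(4)] Ck_on_2D(1)[OF sph2(4)]) auto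
  have inj\<iota>: "inj (fderiv \<iota> y)" if "y \<in> S1 \<times> S2" for y
  proof (rule injI)
    fix u v assume "fderiv \<iota> y u = fderiv \<iota> y v"
    then have "fderiv \<iota>1 (fst y) (fst u) = fderiv \<iota>1 (fst y) (fst v)"
      "fderiv \<iota>2 (snd y) (snd u) = fderiv \<iota>2 (snd y) (snd v)"
      by (simp_all add: f\<iota>[OF that])
    then show "u = v"
      using that injD[OF sph1(5)] injD[OF sph2(5)] by (intro prod_eqI) auto
  qed
  have C\<iota>: "Ck_on 3 (S1 \<times> S2) \<iota>"
    unfolding \<iota>_def
    by (intro Ck_on_Pair openS
        Ck_on_compose[OF openS _ Ck_on_linear[OF bounded_linear_fst] sph1(4)]
        Ck_on_compose[OF openS _ Ck_on_linear[OF bounded_linear_snd] sph2(4)]) auto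
  have gN: "local_metric N k y u v = fderiv \<iota> y u \<bullet> fderiv \<iota> y v" if y: "y \<in> S1 \<times> S2" for y u v
  proof -
    obtain q1 q2 where q: "q1 \<in> chart_dom R1 k1" "q2 \<in> chart_dom R2 k2"
      "y = (chart_map R1 k1 q1, chart_map R2 k2 q2)"
      using y by (auto simp: S1_def S2_def chart_range_def)
    have "local_metric N k y u v = local_metric R1 k1 (fst y) (fst u) (fst v)
        + local_metric R2 k2 (snd y) (snd u) (snd v)"
      using local_metric_warped_product[OF sph1(1) sph2(1) q(1,2), of "\<lambda>_. 1" u v]
      by (simp add: N_eq k q(3))
    also have "\<dots> = fderiv \<iota> y u \<bullet> fderiv \<iota> y v"
      using y by (auto simp: sph1(7) sph2(7) f\<iota>)
    finally show ?thesis .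
  qed

  \<comment> \<open>A coordinate box mapped into one chart of the torus\<close>
  have imm: "smooth_map M N \<phi>"
    "\<And>q u v. chart_at M (i, j) q \<Longrightarrow> chart_at N k (\<phi> q) \<Longrightarrow> inj (differential M (i, j) N k \<phi> q) \<and>
      rmetric M (i, j) q u v = rmetric N k (\<phi> q)
        (differential M (i, j) N k \<phi> q u) (differential M (i, j) N k \<phi> q v)"
    using assms(14) unfolding isometric_immersion_def M_def N_def by blast+
  define W where "W = {q \<in> topspace (mtop M). \<phi> q \<in> chart_dom N k} \<inter> chart_dom M (i, j)"
  have "openin (mtop N) (chart_dom N k)"
    unfolding N_simps using sph1(2) sph2(2) by (simp add: openin_prod_Times_iff)
  then have "openin (mtop M) {q \<in> topspace (mtop M). \<phi> q \<in> chart_dom N k}"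
    using imm(1) unfolding smooth_map_def continuous_map_def by blast
  moreover have "openin (mtop M) (chart_dom M (i, j))"
    unfolding M_simps using openB openF by (simp add: openin_prod_Times_iff)
  ultimately have "openin (prod_topology (mtop B) (mtop F)) W"
    unfolding W_def M_simps(1)[symmetric] by (rule openin_Int)
  moreover have "(fst p, snd p) \<in> W"
    using assms(15) i j kN M_simps(3) by (simp add: W_def M_def chart_at_def mem_Times_iff)
  \<comment> \<open>With a box, openness of its coordinate image follows from the charts of
    \<open>B\<close> and \<open>F\<close> separately, before anything is known about the warped
    product as a manifold.\<close>
  ultimately obtain O1 O2 where O: "openin (mtop B) O1" "openin (mtop F) O2"
    "fst p \<in> O1" "snd p \<in> O2" "O1 \<times> O2 \<subseteq> W"
    unfolding openin_prod_topology_alt by meson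
  have O_dom: "O1 \<subseteq> chart_dom B i" "O2 \<subseteq> chart_dom F j"
    using O(3-5) unfolding W_def M_simps by blast+
  define \<Omega> where "\<Omega> = chart_map B i ` O1 \<times> chart_map F j ` O2"
  have \<Omega>_open: "open \<Omega>"
    unfolding \<Omega>_def
    by (intro open_Times chart_image_open[OF mB i(1)] chart_image_open[OF mF j(1)] O O_dom)
  have z\<Omega>: "z \<in> \<Omega>" using O by (simp add: z_eq \<Omega>_def)
  define h where "h = f \<circ> fst \<circ> chart_inv M (i, j)"
  define \<Phi> where "\<Phi> = local_map M (i, j) N k \<phi>"
  \<comment> \<open>All translations between a coordinate \<open>y\<close> and the point it
    represents, gathered once for the checks that follow.\<close>
  have point: "\<exists>q1 q2. y = (chart_map B i q1, chart_map F j q2) \<and> q1 \<in> chart_dom B i \<and>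
      q2 \<in> chart_dom F j \<and> chart_inv M (i, j) y = (q1, q2) \<and> chart_map M (i, j) (q1, q2) = y \<and>
      chart_at M (i, j) (q1, q2) \<and> chart_at N k (\<phi> (q1, q2)) \<and> \<Phi> y = chart_map N k (\<phi> (q1, q2)) \<and>
      \<Phi> y \<in> S1 \<times> S2 \<and> chart_inv N k (\<Phi> y) = \<phi> (q1, q2) \<and> h y = f q1"
    if y: "y \<in> \<Omega>" for y
  proof -
    obtain q1 q2 where q: "q1 \<in> O1" "q2 \<in> O2" "y = (chart_map B i q1, chart_map F j q2)"
      using y by (auto simp: \<Omega>_def)
    have dom: "q1 \<in> chart_dom B i" "q2 \<in> chart_dom F j" using q O_dom by blast+
    have inv: "chart_inv M (i, j) y = (q1, q2)"
      unfolding M_def q(3) by (rule chart_inv_warped_product[OF injB injF dom])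
    have \<phi>q: "\<phi> (q1, q2) \<in> chart_dom R1 k1 \<times> chart_dom R2 k2"
      using O(5) q N_simps(2) unfolding W_def by blast
    have \<Phi>: "\<Phi> y = chart_map N k (\<phi> (q1, q2))" by (simp add: \<Phi>_def local_map_def inv)
    obtain t1 t2 where t: "\<phi> (q1, q2) = (t1, t2)" "t1 \<in> chart_dom R1 k1" "t2 \<in> chart_dom R2 k2"
      using \<phi>q by (metis mem_Sigma_iff surj_pair)
    have "chart_inv N k (\<Phi> y) = (t1, t2)"
      unfolding \<Phi> t(1) N_simps(3)
      using chart_inv_warped_product[OF sph1(1) sph2(1) t(2,3), of "\<lambda>_. 1"] by (simp add: N_eq k)
    moreover have "\<Phi> y \<in> S1 \<times> S2"
      using t by (simp add: \<Phi> N_simps(3) S1_def S2_def chart_range_def)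
    moreover have "chart_at N k (\<phi> (q1, q2))" using kN \<phi>q by (simp add: chart_at_def N_simps)
    ultimately show ?thesis
      using q dom inv \<Phi> t(1) M_simps by (intro exI[of _ q1] exI[of _ q2]) (auto simp: chart_at_def h_def)
  qed

  \<comment> \<open>Regularity, metric identities and the curvature bound on the box\<close>
  define K where "K = real m / real m1"
  \<comment> \<open>The curvatures of the two spheres are \<open>m / m1\<close> and
    \<open>m / m2\<close>. Since \<open>m1 \<le> m2\<close>, the first is the larger, and it is the
    bound \<open>K\<close>.\<close>
  have m1: "real m1 > 0" and m12: "m1 \<le> m2" using assms(10-12) by auto
  have \<rho>: "r1\<^sup>2 = real m1 / real m" "r2\<^sup>2 = real m2 / real m"
    using assms(8-10) by (simp_all add: r1_def r2_def)
  \<comment> \<open>On the box \<open>h\<close> is the coordinate form of \<open>f\<close> on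
    \<open>B\<close> composed with the first projection.\<close>
  have Ck_h: "Ck_on 2 \<Omega> h"
  proof (rule Ck_on_cong[OF \<Omega>_open])
    have "Ck_on 2 (chart_range B i) (f \<circ> chart_inv B i)"
      using assms(6) i by (simp add: smooth_function_def smooth_on_def)
    then show "Ck_on 2 \<Omega> (\<lambda>y. (f \<circ> chart_inv B i) (fst y))"
      by (rule Ck_on_compose[OF \<Omega>_open _ Ck_on_linear[OF bounded_linear_fst], rotated])
        (use O_dom in \<open>auto simp: \<Omega>_def chart_range_def\<close>)
    fix y assume "y \<in> \<Omega>"
    from point[OF this] obtain q1 q2 where q: "y = (chart_map B i q1, chart_map F j q2)"
      "q1 \<in> chart_dom B i" "h y = f q1" by blast
    then show "(f \<circ> chart_inv B i) (fst y) = h y"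
      by (simp add: chart_inv_def inv_into_f_f[OF injB])
  qed
  have Ck_\<Phi>: "Ck_on 3 \<Omega> \<Phi>"
  proof (rule Ck_on_subset)
    show "Ck_on 3 (chart_map M (i, j) ` {q \<in> chart_dom M (i, j). \<phi> q \<in> chart_dom N k}) \<Phi>"
      using imm(1) M_simps(2) kN by (simp add: smooth_map_def smooth_on_def \<Phi>_def chart_at_def)
    show "\<Omega> \<subseteq> chart_map M (i, j) ` {q \<in> chart_dom M (i, j). \<phi> q \<in> chart_dom N k}"
    proof
      fix y assume "y \<in> \<Omega>"
      from point[OF this] obtain q1 q2 where "chart_map M (i, j) (q1, q2) = y"
        "chart_at M (i, j) (q1, q2)" "chart_at N k (\<phi> (q1, q2))" by blast
      then show "y \<in> chart_map M (i, j) ` {q \<in> chart_dom M (i, j). \<phi> q \<in> chart_dom N k}"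
        by (intro image_eqI[of _ _ "(q1, q2)"]) (auto simp: chart_at_def)
    qed
  qed
  have immersion: "inj (fderiv \<Phi> y)" "local_metric M (i, j) y u v
      = local_metric N k (\<Phi> y) (fderiv \<Phi> y u) (fderiv \<Phi> y v)" if "y \<in> \<Omega>" for y u v
  proof -
    from point[OF that] obtain q1 q2 where q: "chart_inv M (i, j) y = (q1, q2)"
      "chart_map M (i, j) (q1, q2) = y" "chart_at M (i, j) (q1, q2)" "chart_at N k (\<phi> (q1, q2))"
      "chart_inv N k (\<Phi> y) = \<phi> (q1, q2)" by blast
    have "differential M (i, j) N k \<phi> (q1, q2) = fderiv \<Phi> y"
      by (simp add: differential_def q(2) \<Phi>_def)
    then show "inj (fderiv \<Phi> y)" "local_metric M (i, j) y u v
      = local_metric N k (\<Phi> y) (fderiv \<Phi> y u) (fderiv \<Phi> y v)"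
      using imm(2)[OF q(3,4), of u v] by (simp_all add: local_metric_def q(1,5))
  qed
  interpret warped_product_immersion \<Omega> z h "local_metric B i" "local_metric F j"
    "local_metric M (i, j)" \<Phi> "S1 \<times> S2" \<iota> "local_metric N k" K
  proof
    show "h y > 0" if "y \<in> \<Omega>" for y
      using point[OF that] assms(7) openin_subset[OF openB] by (metis subsetD)
    show "local_metric M (i, j) y u v = local_metric B i (fst y) (fst u) (fst v)
        + (h y)\<^sup>2 * local_metric F j (snd y) (snd u) (snd v)" if "y \<in> \<Omega>" for y u v
    proof -
      from point[OF that] obtain q1 q2 where q: "y = (chart_map B i q1, chart_map F j q2)"
        "q1 \<in> chart_dom B i" "q2 \<in> chart_dom F j" "h y = f q1" by blast
      show ?thesis
        using local_metric_warped_product[OF injB injF q(2,3), of f u v] q by (simp add: M_def)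
    qed
    fix y :: "'e1 \<times> 'e2" assume "y \<in> \<Omega>"
    from point[OF this] obtain q1 q2 where q: "y = (chart_map B i q1, chart_map F j q2)"
      "q1 \<in> chart_dom B i" "q2 \<in> chart_dom F j" by blast
    have at: "chart_at B i q1" "chart_at F j q2" using q i j by (simp_all add: chart_at_def)
    show "local_metric B i (fst y) u 0 = 0" "local_metric B i (fst y) 0 u = 0" for u
      using local_metric_zero[OF assms(1) at(1)] by (simp_all add: q)
    show "local_metric F j (snd y) u 0 = 0" "local_metric F j (snd y) 0 u = 0" for u
      using local_metric_zero[OF assms(3) at(2)] by (simp_all add: q)
  next
    show "\<Phi> ` \<Omega> \<subseteq> S1 \<times> S2" using point by blast
    have \<Phi>z: "\<Phi> z \<in> S1 \<times> S2" using point[OF z\<Omega>] by blast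
    then show "inj (fderiv \<iota> (\<Phi> z))" by (rule inj\<iota>)
    fix a b c d
    assume ab: "\<And>w. (second_deriv \<iota> (\<Phi> z) a a - fderiv \<iota> (\<Phi> z) c) \<bullet> fderiv \<iota> (\<Phi> z) w = 0"
      "\<And>w. (second_deriv \<iota> (\<Phi> z) b b - fderiv \<iota> (\<Phi> z) d) \<bullet> fderiv \<iota> (\<Phi> z) w = 0"
    show "(second_deriv \<iota> (\<Phi> z) a a - fderiv \<iota> (\<Phi> z) c) \<bullet> (second_deriv \<iota> (\<Phi> z) b b - fderiv \<iota> (\<Phi> z) d)
      \<le> K * (fderiv \<iota> (\<Phi> z) a \<bullet> fderiv \<iota> (\<Phi> z) a) * (fderiv \<iota> (\<Phi> z) b \<bullet> fderiv \<iota> (\<Phi> z) b)"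
      unfolding \<iota>_def
    proof (rule sphere_product_normal_curvature_le[OF sph1(3,4,6) _ sph2(3,4,6)])
      show "r1\<^sup>2 > 0" "r2\<^sup>2 > 0" using m1 m12 assms(13) by (simp_all add: \<rho>)
      show "\<Phi> z \<in> S1 \<times> S2" by (rule \<Phi>z)
      show "inj (fderiv \<iota>1 (fst (\<Phi> z)))" "inj (fderiv \<iota>2 (snd (\<Phi> z)))"
        using sph1(5) sph2(5) \<Phi>z by auto
      show "1 / r1\<^sup>2 \<le> K" by (simp add: \<rho> K_def)
      show "1 / r2\<^sup>2 \<le> K" using m1 m12 by (simp add: \<rho> K_def frac_le)
    qed (use ab in \<open>simp_all add: \<iota>_def\<close>)
  qed (use \<Omega>_open z\<Omega> Ck_h Ck_\<Phi> immersion openS C\<iota> gN in auto)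

  \<comment> \<open>Laplacian and mean curvature at the point\<close>
  have hz: "h z = f (fst p)"
    using chart_inv_warped_product[OF injB injF i(2) j(2), of f] by (simp add: h_def M_def z_eq)
  define E where "E a = e a (fst z)" for a
  have fz: "fst z = chart_map B i (fst p)" by (simp add: z_eq)
  have frame_e: "local_metric M (i, j) z (E a, 0) (E b, 0) = (if a = b then 1 else 0)"
    if "a \<in> {1..DIM('e1)}" "b \<in> {1..DIM('e1)}" for a b
    using local_orthonormal_frameD(2)[OF assms(16) that] zero(3)[OF z\<Omega>]
    by (simp add: gM[OF z\<Omega>] E_def fz)
  have frame_\<epsilon>: "local_metric M (i, j) z (\<epsilon> a z) (\<epsilon> b z) = (if a = b then 1 else 0)"
    if "a \<in> {1..DIM('e1 \<times> 'e2)}" "b \<in> {1..DIM('e1 \<times> 'e2)}" for a b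
    using local_orthonormal_frameD(2)[OF assms(18) that] by (simp add: z_def M_def)
  have lap: "laplacian B i F j e f p / f (fst p)
    = (\<Sum>a = 1..DIM('e1). (fderiv h z (christoffel (local_metric M (i, j)) z (E a, 0) (E a, 0))
        - second_deriv h z (E a, 0) (E a, 0)) / h z)"
    unfolding laplacian_def Let_def M_def[symmetric] h_def[symmetric] z_def[symmetric] hz[symmetric]
      sum_divide_distrib
  proof (rule sum.cong[OF refl], rule arg_cong[of _ _ "\<lambda>t. t / h z"])
    fix a assume "a \<in> {1..DIM('e1)}"
    then have "e a differentiable (at (fst z))"
      using local_orthonormal_frameD(1)[OF assms(16)] by (simp add: fz)
    from hessian_term_eq[OF horizontal_lift_differentiable[OF this]]
    show "dir_deriv (levi_civita (local_metric M (i, j)) (horizontal_lift (e a)) (horizontal_lift (e a))) h z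
        - dir_deriv (horizontal_lift (e a)) (dir_deriv (horizontal_lift (e a)) h) z
      = fderiv h z (christoffel (local_metric M (i, j)) z (E a, 0) (E a, 0))
        - second_deriv h z (E a, 0) (E a, 0)"
      by (simp add: horizontal_lift_def E_def)
  qed
  \<comment> \<open>The unnormalised trace, \<open>n\<close> times the mean curvature vector; the
    factor returns squared in \<open>sq\<close>.\<close>
  define H where "H = (\<Sum>a = 1..DIM('e1 \<times> 'e2). II (\<epsilon> a z) (\<epsilon> a z))"
  have mean: "mean_curvature_vector M (i, j) N k \<phi> \<epsilon> p = (1 / real n) *\<^sub>R H"
    unfolding mean_curvature_vector_def H_def
  proof (rule arg_cong2[where f = scaleR])
    show "1 / real DIM('e1 \<times> 'e2) = 1 / real n" using assms(2,4,5) by simp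
    show "(\<Sum>a = 1..DIM('e1 \<times> 'e2).
        second_fundamental_form M (i, j) N k \<phi> (\<epsilon> a) (\<epsilon> a) (chart_map M (i, j) p))
      = (\<Sum>a = 1..DIM('e1 \<times> 'e2). II (\<epsilon> a z) (\<epsilon> a z))"
    proof (rule sum.cong[OF refl])
      fix a assume "a \<in> {1..DIM('e1 \<times> 'e2)}"
      then have "\<epsilon> a differentiable (at z)"
        using local_orthonormal_frameD(1)[OF assms(18)] by (simp add: z_def M_def)
      then show "second_fundamental_form M (i, j) N k \<phi> (\<epsilon> a) (\<epsilon> a) (chart_map M (i, j) p)
          = II (\<epsilon> a z) (\<epsilon> a z)"
        unfolding second_fundamental_form_def Let_def \<Phi>_def[symmetric] z_def[symmetric]
        by (rule second_fundamental_form_eq_II)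
    qed
  qed
  have sq: "squared_mean_curvature M (i, j) N k \<phi> \<epsilon> p = local_metric N k (\<Phi> z) H H / (real n)\<^sup>2"
  proof -
    have "chart_inv M (i, j) z = p"
      using chart_inv_warped_product[OF injB injF i(2) j(2), of f] by (simp add: M_def z_eq)
    then have "rmetric N k (\<phi> p) = local_metric N k (\<Phi> z)"
      using point[OF z\<Omega>] by (auto simp: local_metric_def)
    then show ?thesis
      using gN[OF \<phi>z]
      by (simp add: squared_mean_curvature_def mean linear_cmul[OF linear_fderivs(2)] power2_eq_square)
  qed

  \<comment> \<open>Division by the fibre dimension\<close>
  have n: "real n > 0" "real n2 > 0" using assms(2,4,5) by (simp_all add: add_pos_pos)
  have "real n2 * (laplacian B i F j e f p / f (fst p))
      \<le> local_metric N k (\<Phi> z) H H / 4 + real n1 * real n2 * K"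
    unfolding lap H_def assms(2,4)
    using sum_gauss_inequality[of E "\<lambda>a. \<epsilon> a z", OF frame_e frame_\<epsilon>] by simp
  then have "laplacian B i F j e f p / f (fst p)
      \<le> (local_metric N k (\<Phi> z) H H / 4 + real n1 * real n2 * K) / real n2"
    using n by (simp add: pos_le_divide_eq mult.commute)
  also have "\<dots> = (real n)\<^sup>2 / (4 * real n2) * squared_mean_curvature M (i, j) N k \<phi> \<epsilon> p
      + real n1 * real m / real m1"
    using n by (simp add: sq K_def field_simps)
  finally show ?thesis by (simp add: M_def N_def)
qed

end
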